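(* Let $A$ be an artin algebra and $\mathcal F$ an extension-closed full subcategory of $\operatorname{mod}A$ such that $\mathcal F$ is a Frobenius category with respect to its canonical exact structure. If $\mathcal P(\mathcal F)\subseteq{}^\perp A\subseteq\mathcal F$, then $A$ is left weakly Gorenstein and $\mathcal F=\operatorname{gp}(A)$.
   Context: $\operatorname{mod}A$ is the category of finitely generated left $A$-modules. If $\mathcal C$ is an extension-closed full subcategory of $\operatorname{mod}A$, its canonical exact structure is the one induced by the embedding $\mathcal C\subseteq\operatorname{mod}A$ (the conflations are the short exact sequences of $\operatorname{mod}A$ with all terms in $\mathcal C$). An exact category $\mathcal F$ is a Frobenius category if it has enough projective objects and enough injective objects and the projective objects in $\mathcal F$ are exactly the injective objects in $\mathcal F$. $\mathcal P(\mathcal F)$ denotes the full subcategory of projective objects of the exact category $\mathcal F$. ${}^\perp A$ is the class of semi-Gorenstein-projective modules, i.e. modules $M$ with $\operatorname{Ext}^i(M,A)=0$ for all $i\ge1$. A complete projective resolution is a doubly infinite exact sequence $P^\bullet$ of projective left $A$-modules with differentials $d^i\colon P^i\to P^{i+1}$ such that $\operatorname{Hom}_A(P^\bullet,A)$ is again exact; a module is Gorenstein-projective if it is isomorphic to the image of $d^0$ for some complete projective resolution. $\operatorname{gp}(A)$ is the class of Gorenstein-projective modules. $A$ is left weakly Gorenstein if ${}^\perp A=\operatorname{gp}(A)$. *)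

theory Defs
  imports "HOL-Algebra.Module" "HOL-Algebra.Ideal" "HOL-Algebra.Elementary_Groups"
begin

section \<open>Modules over a not necessarily commutative ring\<close>

text \<open>
  The locale \<^locale>\<open>module\<close> of \<^theory>\<open>HOL-Algebra.Module\<close> requires the ring to be commutative.
  The following locale has the same axioms over an arbitrary ring and reuses the record type
  \<^typ>\<open>('a, 'm) module\<close>, whose fields \<^const>\<open>monoid.mult\<close> and \<^const>\<open>one\<close> play no role for modules.
\<close>

locale left_module = A?: ring A + M?: abelian_group M
  for A :: "('a, 'x) ring_scheme" (structure) and M :: "('a, 'm, 'z) module_scheme" (structure) +
  assumes smult_closed:
      "\<lbrakk>a \<in> carrier A; x \<in> carrier M\<rbrakk> \<Longrightarrow> a \<odot>\<^bsub>M\<^esub> x \<in> carrier M"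
    and smult_l_distr:
      "\<lbrakk>a \<in> carrier A; b \<in> carrier A; x \<in> carrier M\<rbrakk> \<Longrightarrow>
        (a \<oplus>\<^bsub>A\<^esub> b) \<odot>\<^bsub>M\<^esub> x = (a \<odot>\<^bsub>M\<^esub> x) \<oplus>\<^bsub>M\<^esub> (b \<odot>\<^bsub>M\<^esub> x)"
    and smult_r_distr:
      "\<lbrakk>a \<in> carrier A; x \<in> carrier M; y \<in> carrier M\<rbrakk> \<Longrightarrow>
        a \<odot>\<^bsub>M\<^esub> (x \<oplus>\<^bsub>M\<^esub> y) = (a \<odot>\<^bsub>M\<^esub> x) \<oplus>\<^bsub>M\<^esub> (a \<odot>\<^bsub>M\<^esub> y)"
    and smult_assoc:
      "\<lbrakk>a \<in> carrier A; b \<in> carrier A; x \<in> carrier M\<rbrakk> \<Longrightarrow>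
        (a \<otimes>\<^bsub>A\<^esub> b) \<odot>\<^bsub>M\<^esub> x = a \<odot>\<^bsub>M\<^esub> (b \<odot>\<^bsub>M\<^esub> x)"
    and smult_one: "x \<in> carrier M \<Longrightarrow> \<one>\<^bsub>A\<^esub> \<odot>\<^bsub>M\<^esub> x = x"

definition finitely_generated ::
    "('a, 'x) ring_scheme \<Rightarrow> ('a, 'm) module \<Rightarrow> bool" where
  "finitely_generated A M \<longleftrightarrow>
    (\<exists>G. finite G \<and> G \<subseteq> carrier M \<and>
      (\<forall>x\<in>carrier M. \<exists>c \<in> G \<rightarrow> carrier A. x = (\<Oplus>\<^bsub>M\<^esub>g\<in>G. c g \<odot>\<^bsub>M\<^esub> g)))"

definition fg_modules :: "('a, 'x) ring_scheme \<Rightarrow> ('a, 'm) module set" where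
  "fg_modules A = {M. left_module A M \<and> finitely_generated A M}"

text \<open>Homomorphisms are extensional, so that they form the actual group Hom(M,N).\<close>

definition mod_hom ::
    "('a, 'x) ring_scheme \<Rightarrow> ('a, 'm) module \<Rightarrow> ('a, 'n) module \<Rightarrow> ('m \<Rightarrow> 'n) set" where
  "mod_hom A M N =
    {f \<in> carrier M \<rightarrow>\<^sub>E carrier N.
      (\<forall>x\<in>carrier M. \<forall>y\<in>carrier M. f (x \<oplus>\<^bsub>M\<^esub> y) = f x \<oplus>\<^bsub>N\<^esub> f y) \<and>
      (\<forall>a\<in>carrier A. \<forall>x\<in>carrier M. f (a \<odot>\<^bsub>M\<^esub> x) = a \<odot>\<^bsub>N\<^esub> f x)}"

definition mod_isomorphic ::
    "('a, 'x) ring_scheme \<Rightarrow> ('a, 'm) module \<Rightarrow> ('a, 'n) module \<Rightarrow> bool" where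
  "mod_isomorphic A M N \<longleftrightarrow> (\<exists>f\<in>mod_hom A M N. bij_betw f (carrier M) (carrier N))"

definition regular_module :: "('a, 'x) ring_scheme \<Rightarrow> ('a, 'a) module" where
  "regular_module A =
    \<lparr>carrier = carrier A, mult = mult A, one = one A, zero = zero A, add = add A,
     smult = mult A\<rparr>"

definition projective_module :: "('a, 'x) ring_scheme \<Rightarrow> ('a, 'm) module \<Rightarrow> bool" where
  "projective_module A P \<longleftrightarrow> left_module A P \<and>
    (\<forall>(Y :: ('a, 'm) module) (Z :: ('a, 'm) module). \<forall>g\<in>mod_hom A Y Z. \<forall>h\<in>mod_hom A P Z.
      left_module A Y \<longrightarrow> left_module A Z \<longrightarrow> g ` carrier Y = carrier Z \<longrightarrow>
      (\<exists>k\<in>mod_hom A P Y. compose (carrier P) g k = h))"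


section \<open>Size of the universe\<close>

text \<open>
  A set of modules \<^typ>\<open>('a, 'm) module set\<close> contains only modules with elements of type
  \<^typ>\<open>'m\<close>.  For it to play the role of a class of objects of the category of all finitely
  generated modules, every such module must have an isomorphic copy with elements in \<^typ>\<open>'m\<close>.
  By the lemma below, an injection \<^typ>\<open>'a list \<Rightarrow> 'm\<close> is enough for this; for
  \<^typ>\<open>'m\<close> one may take \<^typ>\<open>'a list\<close> itself.
\<close>

lemma fg_module_isomorphic_copy:
  fixes A :: "('a, 'x) ring_scheme" and M :: "('a, 'n) module" and \<iota> :: "'a list \<Rightarrow> 'm"
  assumes "inj \<iota>" and "M \<in> fg_modules A"
  shows "\<exists>N :: ('a, 'm) module. N \<in> fg_modules A \<and> mod_isomorphic A M N"
proof -
  interpret left_module A M using assms(2) by (simp add: fg_modules_def)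
  obtain G where G: "finite G" "G \<subseteq> carrier M"
    and gen: "\<forall>x\<in>carrier M. \<exists>c \<in> G \<rightarrow> carrier A. x = (\<Oplus>\<^bsub>M\<^esub>g\<in>G. c g \<odot>\<^bsub>M\<^esub> g)"
    using assms(2) by (auto simp: fg_modules_def finitely_generated_def)
  obtain gs where gs: "set gs = G" using G(1) finite_list by blast
  from gen obtain c where c: "\<And>x. x \<in> carrier M \<Longrightarrow> c x \<in> G \<rightarrow> carrier A"
    "\<And>x. x \<in> carrier M \<Longrightarrow> x = (\<Oplus>\<^bsub>M\<^esub>g\<in>G. c x g \<odot>\<^bsub>M\<^esub> g)" by metis
  define h where "h = (\<lambda>x. \<iota> (map (c x) gs))"
  have sumcl: "(\<Oplus>\<^bsub>M\<^esub>g\<in>G. d g \<odot>\<^bsub>M\<^esub> g) \<in> carrier M" if "d \<in> G \<rightarrow> carrier A" for d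
    using that G(2) by (intro M.finsum_closed) (auto intro!: smult_closed)
  have inj: "inj_on h (carrier M)"
  proof (rule inj_onI)
    fix x y assume x: "x \<in> carrier M" and y: "y \<in> carrier M" and eq: "h x = h y"
    have "map (c x) gs = map (c y) gs" using eq assms(1) by (auto simp: h_def dest: injD)
    then have *: "c x g = c y g" if "g \<in> G" for g using that gs by auto
    have "(\<Oplus>\<^bsub>M\<^esub>g\<in>G. c x g \<odot>\<^bsub>M\<^esub> g) = (\<Oplus>\<^bsub>M\<^esub>g\<in>G. c y g \<odot>\<^bsub>M\<^esub> g)"
      using c(1)[OF y] G(2) * by (intro M.finsum_cong') (auto intro!: smult_closed)
    then show "x = y" using c(2) x y by metis
  qed
  define k where "k = inv_into (carrier M) h"
  have kh [simp]: "k (h x) = x" if "x \<in> carrier M" for x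
    using inj that by (simp add: k_def)
  define N :: "('a, 'm) module" where "N =
    \<lparr>carrier = h ` carrier M, mult = (\<lambda>u v. u), one = h \<zero>\<^bsub>M\<^esub>, zero = h \<zero>\<^bsub>M\<^esub>,
     add = (\<lambda>u v. h (k u \<oplus>\<^bsub>M\<^esub> k v)), smult = (\<lambda>a u. h (a \<odot>\<^bsub>M\<^esub> k u))\<rparr>"
  have N: "carrier N = h ` carrier M" "\<zero>\<^bsub>N\<^esub> = h \<zero>\<^bsub>M\<^esub>"
    "\<And>u v. u \<oplus>\<^bsub>N\<^esub> v = h (k u \<oplus>\<^bsub>M\<^esub> k v)" "\<And>a u. a \<odot>\<^bsub>N\<^esub> u = h (a \<odot>\<^bsub>M\<^esub> k u)"
    by (simp_all add: N_def)
  have "abelian_group N"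
  proof (rule abelian_groupI)
    fix x assume "x \<in> carrier N"
    then obtain u where "u \<in> carrier M" "x = h u" by (auto simp: N)
    then show "\<exists>y\<in>carrier N. y \<oplus>\<^bsub>N\<^esub> x = \<zero>\<^bsub>N\<^esub>"
      by (intro bexI[of _ "h (\<ominus>\<^bsub>M\<^esub> u)"]) (auto simp: N M.l_neg)
  qed (auto simp: N M.add.m_ac)
  then have lm: "left_module A N"
    by (intro left_module.intro left_module_axioms.intro A.ring_axioms)
       (auto simp: N smult_closed smult_l_distr smult_r_distr smult_assoc smult_one)
  interpret N: left_module A N by (fact lm)
  have hsum: "(\<Oplus>\<^bsub>N\<^esub>g\<in>h ` S. d (k g) \<odot>\<^bsub>N\<^esub> g) = h (\<Oplus>\<^bsub>M\<^esub>g\<in>S. d g \<odot>\<^bsub>M\<^esub> g)"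
    if "finite S" "S \<subseteq> carrier M" "d \<in> S \<rightarrow> carrier A" for S d
    using that
  proof (induction S)
    case empty
    show ?case by (simp add: N)
  next
    case (insert s S)
    have *: "h s \<notin> h ` S" using insert.prems insert.hyps inj by (auto dest: inj_onD)
    have cl: "(\<lambda>g. d (k g) \<odot>\<^bsub>N\<^esub> g) \<in> h ` S \<rightarrow> carrier N"
      "d (k (h s)) \<odot>\<^bsub>N\<^esub> h s \<in> carrier N"
      using insert.prems by (auto simp: N Pi_iff subset_iff intro!: imageI smult_closed)
    have cl': "(\<lambda>g. d g \<odot>\<^bsub>M\<^esub> g) \<in> S \<rightarrow> carrier M" "d s \<odot>\<^bsub>M\<^esub> s \<in> carrier M"
      using insert.prems by (auto intro!: smult_closed)
    have "(\<Oplus>\<^bsub>N\<^esub>g\<in>h ` insert s S. d (k g) \<odot>\<^bsub>N\<^esub> g) =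
        (d (k (h s)) \<odot>\<^bsub>N\<^esub> h s) \<oplus>\<^bsub>N\<^esub> (\<Oplus>\<^bsub>N\<^esub>g\<in>h ` S. d (k g) \<odot>\<^bsub>N\<^esub> g)"
      using insert.hyps * cl by (simp add: N.M.finsum_insert)
    also have "\<dots> = h ((d s \<odot>\<^bsub>M\<^esub> s) \<oplus>\<^bsub>M\<^esub> (\<Oplus>\<^bsub>M\<^esub>g\<in>S. d g \<odot>\<^bsub>M\<^esub> g))"
      using insert cl' M.finsum_closed[OF cl'(1)] by (simp add: N)
    also have "\<dots> = h (\<Oplus>\<^bsub>M\<^esub>g\<in>insert s S. d g \<odot>\<^bsub>M\<^esub> g)"
      using insert.hyps cl' by (simp add: M.finsum_insert)
    finally show ?case .
  qed
  have "finitely_generated A N"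
    unfolding finitely_generated_def
  proof (intro exI[of _ "h ` G"] conjI ballI)
    fix x assume "x \<in> carrier N"
    then obtain u where u: "u \<in> carrier M" "x = h u" by (auto simp: N)
    show "\<exists>d\<in>h ` G \<rightarrow> carrier A. x = (\<Oplus>\<^bsub>N\<^esub>g\<in>h ` G. d g \<odot>\<^bsub>N\<^esub> g)"
    proof (intro bexI[of _ "\<lambda>g. c u (k g)"])
      show "x = (\<Oplus>\<^bsub>N\<^esub>g\<in>h ` G. c u (k g) \<odot>\<^bsub>N\<^esub> g)"
        using hsum[OF G c(1)[OF u(1)]] c(2)[OF u(1)] u(2) by simp
      show "(\<lambda>g. c u (k g)) \<in> h ` G \<rightarrow> carrier A"
        using c(1)[OF u(1)] G(2) by (auto simp: subset_iff)
    qed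
  qed (use G in \<open>auto simp: N\<close>)
  moreover have "mod_isomorphic A M N"
    unfolding mod_isomorphic_def
  proof (intro bexI[of _ "restrict h (carrier M)"])
    show "bij_betw (restrict h (carrier M)) (carrier M) (carrier N)"
      using inj by (auto simp: bij_betw_def N inj_on_def)
    show "restrict h (carrier M) \<in> mod_hom A M N"
      by (auto simp: mod_hom_def N smult_closed)
  qed
  ultimately show ?thesis using lm by (auto simp: fg_modules_def)
qed


section \<open>Artin algebras\<close>

definition artinian_cring :: "('r, 'y) ring_scheme \<Rightarrow> bool" where
  "artinian_cring R \<longleftrightarrow> cring R \<and>
    (\<forall>I :: nat \<Rightarrow> 'r set. (\<forall>n. ideal (I n) R \<and> I (Suc n) \<subseteq> I n) \<longrightarrow>
      (\<exists>N. \<forall>n\<ge>N. I n = I N))"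

definition algebra_as_module ::
    "('r \<Rightarrow> 'a) \<Rightarrow> ('a, 'x) ring_scheme \<Rightarrow> ('r, 'a) module" where
  "algebra_as_module \<phi> A =
    \<lparr>carrier = carrier A, mult = mult A, one = one A, zero = zero A, add = add A,
     smult = (\<lambda>r a. \<phi> r \<otimes>\<^bsub>A\<^esub> a)\<rparr>"

text \<open>
  The algebra structure is given by a ring homomorphism from the base ring into the centre.
\<close>

definition artin_algebra ::
    "('r, 'y) ring_scheme \<Rightarrow> ('r \<Rightarrow> 'a) \<Rightarrow> ('a, 'x) ring_scheme \<Rightarrow> bool" where
  "artin_algebra R \<phi> A \<longleftrightarrow>
    artinian_cring R \<and> ring A \<and> \<phi> \<in> ring_hom R A \<and>
    (\<forall>r\<in>carrier R. \<forall>a\<in>carrier A. \<phi> r \<otimes>\<^bsub>A\<^esub> a = a \<otimes>\<^bsub>A\<^esub> \<phi> r) \<and>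
    finitely_generated R (algebra_as_module \<phi> A)"


section \<open>Extension-closed subcategories and their canonical exact structure\<close>

definition short_exact ::
    "('a, 'x) ring_scheme \<Rightarrow> ('a, 'm) module \<Rightarrow> ('a, 'm) module \<Rightarrow> ('a, 'm) module \<Rightarrow>
     ('m \<Rightarrow> 'm) \<Rightarrow> ('m \<Rightarrow> 'm) \<Rightarrow> bool" where
  "short_exact A X Y Z f g \<longleftrightarrow>
    f \<in> mod_hom A X Y \<and> g \<in> mod_hom A Y Z \<and> inj_on f (carrier X) \<and>
    f ` carrier X = a_kernel Y Z g \<and> g ` carrier Y = carrier Z"

text \<open>
  Full subcategories are given by their sets of objects.  Closure under isomorphism is not
  required separately: it follows from closure under extensions once a zero module belongs
  to the subcategory.
\<close>

definition extension_closed ::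
    "('a, 'x) ring_scheme \<Rightarrow> ('a, 'm) module set \<Rightarrow> bool" where
  "extension_closed A F \<longleftrightarrow>
    (\<forall>X\<in>F. \<forall>Z\<in>F. \<forall>Y\<in>fg_modules A. \<forall>f g. short_exact A X Y Z f g \<longrightarrow> Y \<in> F)"

definition conflation ::
    "('a, 'x) ring_scheme \<Rightarrow> ('a, 'm) module set \<Rightarrow> ('a, 'm) module \<Rightarrow> ('a, 'm) module \<Rightarrow>
     ('a, 'm) module \<Rightarrow> ('m \<Rightarrow> 'm) \<Rightarrow> ('m \<Rightarrow> 'm) \<Rightarrow> bool" where
  "conflation A F X Y Z f g \<longleftrightarrow> X \<in> F \<and> Y \<in> F \<and> Z \<in> F \<and> short_exact A X Y Z f g"

definition projective_objects ::
    "('a, 'x) ring_scheme \<Rightarrow> ('a, 'm) module set \<Rightarrow> ('a, 'm) module set" where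
  "projective_objects A F =
    {P \<in> F. \<forall>X Y Z f g. conflation A F X Y Z f g \<longrightarrow>
      (\<forall>h\<in>mod_hom A P Z. \<exists>k\<in>mod_hom A P Y. compose (carrier P) g k = h)}"

definition injective_objects ::
    "('a, 'x) ring_scheme \<Rightarrow> ('a, 'm) module set \<Rightarrow> ('a, 'm) module set" where
  "injective_objects A F =
    {I \<in> F. \<forall>X Y Z f g. conflation A F X Y Z f g \<longrightarrow>
      (\<forall>h\<in>mod_hom A X I. \<exists>k\<in>mod_hom A Y I. compose (carrier X) k f = h)}"

definition frobenius_category ::
    "('a, 'x) ring_scheme \<Rightarrow> ('a, 'm) module set \<Rightarrow> bool" where
  "frobenius_category A F \<longleftrightarrow>
    (\<forall>Z\<in>F. \<exists>X P f g. P \<in> projective_objects A F \<and> conflation A F X P Z f g) \<and>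
    (\<forall>X\<in>F. \<exists>I Z f g. I \<in> injective_objects A F \<and> conflation A F X I Z f g) \<and>
    projective_objects A F = injective_objects A F"


section \<open>Hom complexes and Ext groups\<close>

definition Hom_group ::
    "('a, 'x) ring_scheme \<Rightarrow> ('a, 'm) module \<Rightarrow> ('a, 'n) module \<Rightarrow> ('m \<Rightarrow> 'n) monoid" where
  "Hom_group A M N =
    \<lparr>carrier = mod_hom A M N,
     mult = (\<lambda>f g. \<lambda>x\<in>carrier M. f x \<oplus>\<^bsub>N\<^esub> g x),
     one = (\<lambda>x\<in>carrier M. \<zero>\<^bsub>N\<^esub>)\<rparr>"

definition projective_resolution ::
    "('a, 'x) ring_scheme \<Rightarrow> ('a, 'm) module \<Rightarrow> (nat \<Rightarrow> ('a, 'm) module) \<Rightarrow>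
     (nat \<Rightarrow> 'm \<Rightarrow> 'm) \<Rightarrow> ('m \<Rightarrow> 'm) \<Rightarrow> bool" where
  "projective_resolution A M P d \<epsilon> \<longleftrightarrow>
    (\<forall>n. P n \<in> fg_modules A \<and> projective_module A (P n)) \<and>
    (\<forall>n. d n \<in> mod_hom A (P (Suc n)) (P n)) \<and>
    \<epsilon> \<in> mod_hom A (P 0) M \<and>
    \<epsilon> ` carrier (P 0) = carrier M \<and>
    d 0 ` carrier (P 1) = a_kernel (P 0) M \<epsilon> \<and>
    (\<forall>n. d (Suc n) ` carrier (P (Suc (Suc n))) = a_kernel (P (Suc n)) (P n) (d n))"

definition cocycles ::
    "('a, 'x) ring_scheme \<Rightarrow> (nat \<Rightarrow> ('a, 'm) module) \<Rightarrow> (nat \<Rightarrow> 'm \<Rightarrow> 'm) \<Rightarrow>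
     ('a, 'n) module \<Rightarrow> nat \<Rightarrow> ('m \<Rightarrow> 'n) set" where
  "cocycles A P d N i =
    kernel (Hom_group A (P i) N) (Hom_group A (P (Suc i)) N)
      (\<lambda>f. compose (carrier (P (Suc i))) f (d i))"

fun coboundaries ::
    "('a, 'x) ring_scheme \<Rightarrow> (nat \<Rightarrow> ('a, 'm) module) \<Rightarrow> (nat \<Rightarrow> 'm \<Rightarrow> 'm) \<Rightarrow>
     ('a, 'n) module \<Rightarrow> nat \<Rightarrow> ('m \<Rightarrow> 'n) set" where
  "coboundaries A P d N 0 = {\<one>\<^bsub>Hom_group A (P 0) N\<^esub>}"
| "coboundaries A P d N (Suc i) =
    (\<lambda>f. compose (carrier (P (Suc i))) f (d i)) ` mod_hom A (P i) N"

definition Ext_of_resolution ::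
    "('a, 'x) ring_scheme \<Rightarrow> nat \<Rightarrow> (nat \<Rightarrow> ('a, 'm) module) \<Rightarrow> (nat \<Rightarrow> 'm \<Rightarrow> 'm) \<Rightarrow>
     ('a, 'n) module \<Rightarrow> ('m \<Rightarrow> 'n) set monoid" where
  "Ext_of_resolution A i P d N =
    (Hom_group A (P i) N)\<lparr>carrier := cocycles A P d N i\<rparr> Mod coboundaries A P d N i"

text \<open>
  Ext is computed from a chosen resolution by finitely generated projective modules.  Such
  resolutions exist for finitely generated modules over a left noetherian ring, hence over an
  Artin algebra, and up to isomorphism the result does not depend on the choice.
\<close>

definition Ext ::
    "('a, 'x) ring_scheme \<Rightarrow> nat \<Rightarrow> ('a, 'm) module \<Rightarrow> ('a, 'n) module \<Rightarrow>
     ('m \<Rightarrow> 'n) set monoid" where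
  "Ext A i M N =
    (let (P, d) = (SOME (P, d). \<exists>\<epsilon>. projective_resolution A M P d \<epsilon>)
     in Ext_of_resolution A i P d N)"


section \<open>Semi-Gorenstein-projective and Gorenstein-projective modules\<close>

definition semi_gorenstein_projective ::
    "('a, 'x) ring_scheme \<Rightarrow> ('a, 'm) module set" where
  "semi_gorenstein_projective A =
    {M \<in> fg_modules A. \<forall>i\<ge>1. trivial_group (Ext A i M (regular_module A))}"

definition complete_projective_resolution ::
    "('a, 'x) ring_scheme \<Rightarrow> (int \<Rightarrow> ('a, 'm) module) \<Rightarrow> (int \<Rightarrow> 'm \<Rightarrow> 'm) \<Rightarrow> bool" where
  "complete_projective_resolution A P d \<longleftrightarrow>
    (\<forall>i. P i \<in> fg_modules A \<and> projective_module A (P i)) \<and>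
    (\<forall>i. d i \<in> mod_hom A (P i) (P (i + 1))) \<and>
    (\<forall>i. d i ` carrier (P i) = a_kernel (P (i + 1)) (P (i + 2)) (d (i + 1))) \<and>
    (\<forall>i. (\<lambda>f. compose (carrier (P (i + 1))) f (d (i + 1)))
            ` mod_hom A (P (i + 2)) (regular_module A) =
          kernel (Hom_group A (P (i + 1)) (regular_module A))
            (Hom_group A (P i) (regular_module A))
            (\<lambda>f. compose (carrier (P i)) f (d i)))"

definition gorenstein_projective ::
    "('a, 'x) ring_scheme \<Rightarrow> ('a, 'm) module set" where
  "gorenstein_projective A =
    {M \<in> fg_modules A. \<exists>(P :: int \<Rightarrow> ('a, 'm) module) d.
      complete_projective_resolution A P d \<and>
      mod_isomorphic A M ((P 1)\<lparr>carrier := d 0 ` carrier (P 0)\<rparr>)}"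

text \<open>The first argument fixes the universe in which modules live.\<close>

definition left_weakly_gorenstein ::
    "'m itself \<Rightarrow> ('a, 'x) ring_scheme \<Rightarrow> bool" where
  "left_weakly_gorenstein U A \<longleftrightarrow>
    (semi_gorenstein_projective A :: ('a, 'm) module set) = gorenstein_projective A"

end

theory Submission
  imports Defs
begin

text \<open>
  The theorem follows from a circle of inclusions: the semi-Gorenstein-projective modules lie in
  \<open>F\<close> by assumption, \<open>F\<close> lies in the class of Gorenstein-projective modules,
  and these are semi-Gorenstein-projective.

  The last inclusion holds because half of a complete projective resolution is a projective
  resolution whose Hom complex is exact (\<open>gorenstein_projective_semi\<close>).  For the inclusion
  of \<open>F\<close> in the Gorenstein-projective modules, the key point is that the projective
  objects of \<open>F\<close> are just the finitely generated projective modules.  A projective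
  module is semi-Gorenstein-projective, so it lies in \<open>F\<close> and is a projective object
  there.  Conversely, let \<open>Q\<close> be a projective object.  It is semi-Gorenstein-projective by
  assumption, so its first syzygy is, too, by dimension shifting; hence the presentation of
  \<open>Q\<close> by a projective module is a conflation of \<open>F\<close>, which splits
  (\<open>projective_object_projective_module\<close>).  As \<open>F\<close> is a Frobenius category, the
  regular module is therefore injective in \<open>F\<close>, and every object of \<open>F\<close>
  has conflations to both sides whose middle terms are projective modules.  Splicing these gives a
  doubly infinite exact sequence, which stays exact under maps into the regular module by injectivity
  (\<open>splice_complete_projective_resolution\<close>).

  Two general facts enter.  Since Ext is computed from a chosen resolution, its vanishing must be
  shown to be independent of the choice (\<open>semi_gorenstein_projective_iff\<close>).  And the syzygies
  of finitely generated modules must be finitely generated, i.e. an artin algebra must be left noetherian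
  (\<open>artin_algebra_noetherian\<close>), which rests on the fact that commutative artinian rings
  are noetherian.
\<close>

section \<open>Linear maps\<close>

lemma (in abelian_group) diff_eq_zero_iff:
  assumes "x \<in> carrier G" and "y \<in> carrier G"
  shows "x \<ominus> y = \<zero> \<longleftrightarrow> x = y"
  using assms minus_equality[of x "\<ominus> y"] by (auto simp: minus_eq r_neg)

text \<open>
  Membership in \<^const>\<open>mod_hom\<close> forces a map to be \<^const>\<open>undefined\<close> off its domain, so
  that composites and sums of elements of \<^const>\<open>mod_hom\<close> have to be restricted again and again.
  Linear maps without this condition compose and add freely; \<open>restrict_mod_hom\<close> and
  \<open>mod_hom_lin\<close> translate between the two, and a restriction happens only where a
  statement speaks of Hom groups, conflations or resolutions.
\<close>

definition lin ::
    "('a, 'x) ring_scheme \<Rightarrow> ('a, 'm) module \<Rightarrow> ('a, 'n) module \<Rightarrow> ('m \<Rightarrow> 'n) \<Rightarrow> bool" where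
  "lin A M N f \<longleftrightarrow> f \<in> carrier M \<rightarrow> carrier N \<and>
    (\<forall>x\<in>carrier M. \<forall>y\<in>carrier M. f (x \<oplus>\<^bsub>M\<^esub> y) = f x \<oplus>\<^bsub>N\<^esub> f y) \<and>
    (\<forall>a\<in>carrier A. \<forall>x\<in>carrier M. f (a \<odot>\<^bsub>M\<^esub> x) = a \<odot>\<^bsub>N\<^esub> f x)"

lemma linI:
  assumes "\<And>x. x \<in> carrier M \<Longrightarrow> f x \<in> carrier N"
    and "\<And>x y. x \<in> carrier M \<Longrightarrow> y \<in> carrier M \<Longrightarrow> f (x \<oplus>\<^bsub>M\<^esub> y) = f x \<oplus>\<^bsub>N\<^esub> f y"
    and "\<And>a x. a \<in> carrier A \<Longrightarrow> x \<in> carrier M \<Longrightarrow> f (a \<odot>\<^bsub>M\<^esub> x) = a \<odot>\<^bsub>N\<^esub> f x"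
  shows "lin A M N f"
  using assms by (auto simp: lin_def)

lemma lin_closed: "lin A M N f \<Longrightarrow> x \<in> carrier M \<Longrightarrow> f x \<in> carrier N"
  and lin_add: "lin A M N f \<Longrightarrow> x \<in> carrier M \<Longrightarrow> y \<in> carrier M \<Longrightarrow> f (x \<oplus>\<^bsub>M\<^esub> y) = f x \<oplus>\<^bsub>N\<^esub> f y"
  and lin_smult: "lin A M N f \<Longrightarrow> a \<in> carrier A \<Longrightarrow> x \<in> carrier M \<Longrightarrow> f (a \<odot>\<^bsub>M\<^esub> x) = a \<odot>\<^bsub>N\<^esub> f x"
  by (auto simp: lin_def)

lemma mod_hom_iff: "f \<in> mod_hom A M N \<longleftrightarrow> lin A M N f \<and> f \<in> extensional (carrier M)"
  by (auto simp: mod_hom_def lin_def PiE_def)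

lemma mod_hom_lin: "f \<in> mod_hom A M N \<Longrightarrow> lin A M N f"
  by (simp add: mod_hom_iff)

lemma lin_cong:
  assumes "left_module A M" and "lin A M N f" and "\<And>x. x \<in> carrier M \<Longrightarrow> g x = f x"
  shows "lin A M N g"
proof -
  interpret M: left_module A M by fact
  show ?thesis using assms(2,3) by (auto simp: lin_def M.smult_closed)
qed

lemma restrict_mod_hom:
  assumes "left_module A M" and "lin A M N f"
  shows "restrict f (carrier M) \<in> mod_hom A M N"
  using lin_cong[OF assms, of "restrict f (carrier M)"] by (simp add: mod_hom_iff)

lemma lin_comp:
  assumes "lin A M N f" and "lin A N L g"
  shows "lin A M L (\<lambda>x. g (f x))"
  using assms by (auto simp: lin_def Pi_iff)

lemma lin_id: "lin A M M (\<lambda>x. x)"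
  by (simp add: lin_def)

lemma lin_zero:
  assumes "left_module A M" and "left_module A N" and "lin A M N f"
  shows "f \<zero>\<^bsub>M\<^esub> = \<zero>\<^bsub>N\<^esub>"
proof -
  interpret M: left_module A M by fact
  interpret N: left_module A N by fact
  have "f \<zero>\<^bsub>M\<^esub> \<oplus>\<^bsub>N\<^esub> f \<zero>\<^bsub>M\<^esub> = f \<zero>\<^bsub>M\<^esub>"
    using lin_add[OF assms(3), of "\<zero>\<^bsub>M\<^esub>" "\<zero>\<^bsub>M\<^esub>"] by simp
  then show ?thesis using lin_closed[OF assms(3)] N.M.add.r_cancel_one by simp
qed

lemma smult_zero_right:
  assumes "left_module A M" and "a \<in> carrier A"
  shows "a \<odot>\<^bsub>M\<^esub> \<zero>\<^bsub>M\<^esub> = \<zero>\<^bsub>M\<^esub>"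
proof -
  interpret M: left_module A M by fact
  have "a \<odot>\<^bsub>M\<^esub> \<zero>\<^bsub>M\<^esub> \<oplus>\<^bsub>M\<^esub> a \<odot>\<^bsub>M\<^esub> \<zero>\<^bsub>M\<^esub> = a \<odot>\<^bsub>M\<^esub> \<zero>\<^bsub>M\<^esub>"
    using M.smult_r_distr[OF assms(2), of "\<zero>\<^bsub>M\<^esub>" "\<zero>\<^bsub>M\<^esub>"] by simp
  then show ?thesis using M.smult_closed[OF assms(2)] M.M.add.r_cancel_one by simp
qed

lemma smult_zero_left:
  assumes "left_module A M" and "x \<in> carrier M"
  shows "\<zero>\<^bsub>A\<^esub> \<odot>\<^bsub>M\<^esub> x = \<zero>\<^bsub>M\<^esub>"
proof -
  interpret M: left_module A M by fact
  have "\<zero>\<^bsub>A\<^esub> \<odot>\<^bsub>M\<^esub> x \<oplus>\<^bsub>M\<^esub> \<zero>\<^bsub>A\<^esub> \<odot>\<^bsub>M\<^esub> x = \<zero>\<^bsub>A\<^esub> \<odot>\<^bsub>M\<^esub> x"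
    using M.smult_l_distr[of "\<zero>\<^bsub>A\<^esub>" "\<zero>\<^bsub>A\<^esub>" x] assms(2) by simp
  then show ?thesis using M.smult_closed assms(2) M.M.add.r_cancel_one by simp
qed

lemma smult_minus_one:
  assumes "left_module A M" and "x \<in> carrier M"
  shows "(\<ominus>\<^bsub>A\<^esub> \<one>\<^bsub>A\<^esub>) \<odot>\<^bsub>M\<^esub> x = \<ominus>\<^bsub>M\<^esub> x"
proof -
  interpret M: left_module A M by fact
  have "(\<ominus>\<^bsub>A\<^esub> \<one>\<^bsub>A\<^esub>) \<odot>\<^bsub>M\<^esub> x \<oplus>\<^bsub>M\<^esub> x = \<zero>\<^bsub>M\<^esub>"
    using M.smult_l_distr[of "\<ominus>\<^bsub>A\<^esub> \<one>\<^bsub>A\<^esub>" "\<one>\<^bsub>A\<^esub>" x] assms(2)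
    by (simp add: M.smult_one M.A.l_neg smult_zero_left[OF assms])
  then show ?thesis
    using M.M.minus_equality[of "(\<ominus>\<^bsub>A\<^esub> \<one>\<^bsub>A\<^esub>) \<odot>\<^bsub>M\<^esub> x" x] M.smult_closed assms(2) by simp
qed

lemma lin_minus:
  assumes "left_module A M" and "left_module A N" and "lin A M N f" and "x \<in> carrier M"
  shows "f (\<ominus>\<^bsub>M\<^esub> x) = \<ominus>\<^bsub>N\<^esub> f x"
proof -
  interpret M: left_module A M by fact
  show ?thesis
    using lin_smult[OF assms(3), of "\<ominus>\<^bsub>A\<^esub> \<one>\<^bsub>A\<^esub>" x] lin_closed[OF assms(3,4)] assms(4)
    by (simp add: smult_minus_one[OF assms(1)] smult_minus_one[OF assms(2)])
qed

lemma lin_diff: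
  assumes "left_module A M" and "left_module A N" and "lin A M N f"
    and "x \<in> carrier M" and "y \<in> carrier M"
  shows "f (x \<ominus>\<^bsub>M\<^esub> y) = f x \<ominus>\<^bsub>N\<^esub> f y"
proof -
  interpret M: left_module A M by fact
  show ?thesis
    using assms by (simp add: a_minus_def lin_add lin_minus)
qed

lemma smult_minus_right:
  assumes "left_module A M" and "a \<in> carrier A" and "x \<in> carrier M"
  shows "a \<odot>\<^bsub>M\<^esub> (\<ominus>\<^bsub>M\<^esub> x) = \<ominus>\<^bsub>M\<^esub> (a \<odot>\<^bsub>M\<^esub> x)"
proof -
  interpret M: left_module A M by fact
  have "a \<odot>\<^bsub>M\<^esub> (\<ominus>\<^bsub>M\<^esub> x) \<oplus>\<^bsub>M\<^esub> a \<odot>\<^bsub>M\<^esub> x = \<zero>\<^bsub>M\<^esub>"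
    using M.smult_r_distr[OF assms(2), of "\<ominus>\<^bsub>M\<^esub> x" x] assms(2,3)
    by (simp add: M.M.l_neg smult_zero_right[OF assms(1)])
  then show ?thesis
    using M.M.minus_equality M.smult_closed assms(2,3) by (metis M.M.a_inv_closed)
qed

lemma lin_plus:
  assumes "left_module A N" and "lin A M N f" and "lin A M N g"
  shows "lin A M N (\<lambda>x. f x \<oplus>\<^bsub>N\<^esub> g x)"
proof -
  interpret N: left_module A N by fact
  show ?thesis
    using assms(2,3) by (intro linI) (auto simp: lin_closed lin_add lin_smult N.smult_r_distr N.M.a_ac)
qed

lemma lin_uminus:
  assumes "left_module A N" and "lin A M N f"
  shows "lin A M N (\<lambda>x. \<ominus>\<^bsub>N\<^esub> f x)"
proof -
  interpret N: left_module A N by fact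
  show ?thesis
    using assms(2) by (intro linI)
      (auto simp: lin_closed lin_add lin_smult N.M.minus_add N.M.a_ac smult_minus_right[OF assms(1)])
qed

lemma lin_sub:
  assumes "left_module A N" and "lin A M N f" and "lin A M N g"
  shows "lin A M N (\<lambda>x. f x \<ominus>\<^bsub>N\<^esub> g x)"
  using lin_plus[OF assms(1,2) lin_uminus[OF assms(1,3)]] by (simp add: a_minus_def)

lemma lin_const_zero:
  assumes "left_module A N"
  shows "lin A M N (\<lambda>x. \<zero>\<^bsub>N\<^esub>)"
proof -
  interpret N: left_module A N by fact
  show ?thesis by (simp add: lin_def smult_zero_right[OF assms])
qed

lemma lin_inv_into:
  assumes "left_module A M" and "lin A M N f" and "bij_betw f (carrier M) (carrier N)"
  shows "lin A N M (inv_into (carrier M) f)"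
proof -
  interpret M: left_module A M by fact
  let ?g = "inv_into (carrier M) f"
  have g: "?g y \<in> carrier M" "f (?g y) = y" if "y \<in> carrier N" for y
    using assms(3) that by (auto simp: bij_betw_def inv_into_into f_inv_into_f)
  have gf: "?g (f x) = x" if "x \<in> carrier M" for x
    using assms(3) that by (auto simp: bij_betw_def)
  show ?thesis
  proof (rule linI)
    fix x y assume x: "x \<in> carrier N" and y: "y \<in> carrier N"
    show "?g (x \<oplus>\<^bsub>N\<^esub> y) = ?g x \<oplus>\<^bsub>M\<^esub> ?g y"
      using gf[of "?g x \<oplus>\<^bsub>M\<^esub> ?g y"] g[OF x] g[OF y] by (simp add: lin_add[OF assms(2)])
  next
    fix a x assume a: "a \<in> carrier A" and x: "x \<in> carrier N"
    show "?g (a \<odot>\<^bsub>N\<^esub> x) = a \<odot>\<^bsub>M\<^esub> ?g x"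
      using gf[of "a \<odot>\<^bsub>M\<^esub> ?g x"] g[OF x] a by (simp add: lin_smult[OF assms(2)] M.smult_closed)
  qed (use g in auto)
qed

text \<open>
  The universal property of a cokernel: splicing will turn a map that vanishes on a kernel into
  a map on the next term of the sequence.
\<close>

lemma lin_factor_surj:
  assumes P: "left_module A P" and X: "left_module A X" and N: "left_module A N"
    and g: "lin A P X g" "g ` carrier P = carrier X"
    and f: "lin A P N f" and ker: "\<And>x. x \<in> carrier P \<Longrightarrow> g x = \<zero>\<^bsub>X\<^esub> \<Longrightarrow> f x = \<zero>\<^bsub>N\<^esub>"
  obtains f' where "lin A X N f'" and "\<And>x. x \<in> carrier P \<Longrightarrow> f' (g x) = f x"
proof -
  interpret P: left_module A P by fact
  interpret X: left_module A X by fact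
  interpret N: left_module A N by fact
  define s where "s = inv_into (carrier P) g"
  have s: "s y \<in> carrier P" "g (s y) = y" if "y \<in> carrier X" for y
    using that g(2) by (auto simp: s_def inv_into_into f_inv_into_f)
  have eq: "f x = f y" if "x \<in> carrier P" "y \<in> carrier P" "g x = g y" for x y
  proof -
    have "f (x \<ominus>\<^bsub>P\<^esub> y) = \<zero>\<^bsub>N\<^esub>"
      using that lin_closed[OF g(1)]
      by (intro ker) (auto simp: lin_diff[OF P X g(1)] X.M.diff_eq_zero_iff)
    then show ?thesis
      using that lin_closed[OF f] by (simp add: lin_diff[OF P N f] N.M.diff_eq_zero_iff)
  qed
  have f's: "f (s (g x)) = f x" if "x \<in> carrier P" for x
    using that s lin_closed[OF g(1)] by (intro eq) auto
  have "lin A X N (\<lambda>y. f (s y))"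
  proof (rule linI)
    fix x y assume x: "x \<in> carrier X" and y: "y \<in> carrier X"
    show "f (s (x \<oplus>\<^bsub>X\<^esub> y)) = f (s x) \<oplus>\<^bsub>N\<^esub> f (s y)"
      using f's[of "s x \<oplus>\<^bsub>P\<^esub> s y"] s x y by (simp add: lin_add[OF g(1)] lin_add[OF f])
  next
    fix a x assume a: "a \<in> carrier A" and x: "x \<in> carrier X"
    show "f (s (a \<odot>\<^bsub>X\<^esub> x)) = a \<odot>\<^bsub>N\<^esub> f (s x)"
      using f's[of "a \<odot>\<^bsub>P\<^esub> s x"] s x a
      by (simp add: lin_smult[OF g(1)] lin_smult[OF f] P.smult_closed)
  qed (use s lin_closed[OF f] in auto)
  then show ?thesis using f's that by blast
qed


section \<open>Submodules\<close>

text \<open>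
  A submodule is kept as a subset of the carrier, so that submodules of \<open>M\<close> share the
  operations of \<open>M\<close>, and linear combinations formed in them agree literally
  with those formed in \<open>M\<close>.
\<close>

definition submod :: "('a, 'x) ring_scheme \<Rightarrow> ('a, 'm) module \<Rightarrow> 'm set \<Rightarrow> bool" where
  "submod A M S \<longleftrightarrow> S \<subseteq> carrier M \<and> \<zero>\<^bsub>M\<^esub> \<in> S \<and>
    (\<forall>x\<in>S. \<forall>y\<in>S. x \<oplus>\<^bsub>M\<^esub> y \<in> S) \<and> (\<forall>a\<in>carrier A. \<forall>x\<in>S. a \<odot>\<^bsub>M\<^esub> x \<in> S)"

lemma submod_carrier: "left_module A M \<Longrightarrow> submod A M (carrier M)"
proof -
  assume "left_module A M"
  then interpret M: left_module A M .
  show ?thesis by (simp add: submod_def M.smult_closed)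
qed

lemma submod_diff:
  assumes "left_module A M" and "submod A M S" and "x \<in> S" and "y \<in> S"
  shows "x \<ominus>\<^bsub>M\<^esub> y \<in> S"
proof -
  interpret M: left_module A M by fact
  have "\<ominus>\<^bsub>M\<^esub> y \<in> S"
    using smult_minus_one[OF assms(1), of y] assms M.A.a_inv_closed[OF M.A.one_closed]
    by (metis submod_def subset_iff)
  then show ?thesis using assms by (auto simp: submod_def a_minus_def)
qed

lemma left_module_submod:
  assumes "left_module A M" and "submod A M S"
  shows "left_module A (M\<lparr>carrier := S\<rparr>)"
proof -
  interpret M: left_module A M by fact
  have S: "x \<in> carrier M" if "x \<in> S" for x using assms(2) that by (auto simp: submod_def)
  have "\<ominus>\<^bsub>M\<^esub> y \<in> S" if "y \<in> S" for y
    using smult_minus_one[OF assms(1), of y] assms that M.A.a_inv_closed[OF M.A.one_closed]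
    by (metis submod_def subset_iff)
  then have inv: "\<exists>y\<in>S. y \<oplus>\<^bsub>M\<^esub> x = \<zero>\<^bsub>M\<^esub>" if "x \<in> S" for x
    using that S M.M.l_neg by blast
  have "abelian_group (M\<lparr>carrier := S\<rparr>)"
    using assms(2) inv S by (intro abelian_groupI) (auto simp: submod_def M.M.a_ac)
  then show ?thesis
    using assms(2) S by (intro left_module.intro left_module_axioms.intro M.A.ring_axioms)
      (auto simp: submod_def M.smult_l_distr M.smult_r_distr M.smult_assoc M.smult_one)
qed

lemma submod_image:
  assumes "left_module A M" and "left_module A N" and "lin A M N f" and "submod A M S"
  shows "submod A N (f ` S)"
  unfolding submod_def
proof (intro conjI ballI)
  have S: "S \<subseteq> carrier M" using assms(4) by (simp add: submod_def)
  show "f ` S \<subseteq> carrier N" using S lin_closed[OF assms(3)] by auto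
  show "\<zero>\<^bsub>N\<^esub> \<in> f ` S"
    using assms(4) lin_zero[OF assms(1-3)] by (intro image_eqI[of _ _ "\<zero>\<^bsub>M\<^esub>"]) (auto simp: submod_def)
  fix x assume "x \<in> f ` S"
  then obtain u where u: "u \<in> S" "x = f u" by auto
  { fix y assume "y \<in> f ` S"
    then obtain v where v: "v \<in> S" "y = f v" by auto
    have "f (u \<oplus>\<^bsub>M\<^esub> v) = x \<oplus>\<^bsub>N\<^esub> y" using u v S lin_add[OF assms(3)] by auto
    then show "x \<oplus>\<^bsub>N\<^esub> y \<in> f ` S" using u v assms(4) by (metis submod_def imageI) }
  { fix a assume a: "a \<in> carrier A"
    have "f (a \<odot>\<^bsub>M\<^esub> u) = a \<odot>\<^bsub>N\<^esub> x" using a u S lin_smult[OF assms(3)] by auto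
    then show "a \<odot>\<^bsub>N\<^esub> x \<in> f ` S" using u a assms(4) by (metis submod_def imageI) }
qed

lemma submod_vimage:
  assumes "left_module A M" and "left_module A N" and "lin A M N f"
    and "submod A M S" and "submod A N T"
  shows "submod A M {x \<in> S. f x \<in> T}"
  using assms(4,5) lin_zero[OF assms(1-3)]
  by (auto simp: submod_def lin_add[OF assms(3)] lin_smult[OF assms(3)] subset_iff)

lemma submod_zero:
  assumes "left_module A M"
  shows "submod A M {\<zero>\<^bsub>M\<^esub>}"
proof -
  interpret M: left_module A M by fact
  show ?thesis by (simp add: submod_def smult_zero_right[OF assms])
qed

lemma a_kernel_eq: "a_kernel M N f = {x \<in> carrier M. f x = \<zero>\<^bsub>N\<^esub>}"
  by (simp add: a_kernel_def kernel_def)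

lemma submod_kernel:
  assumes "left_module A M" and "left_module A N" and "lin A M N f"
  shows "submod A M (a_kernel M N f)"
  using submod_vimage[OF assms submod_carrier[OF assms(1)] submod_zero[OF assms(2)]]
  by (simp add: a_kernel_eq)


section \<open>Linear combinations and finite generation\<close>

text \<open>
  Lists of generators, rather than the finite sets of \<^const>\<open>finitely_generated\<close>, allow
  repeated generators.  Images and extensions of finitely generated modules are then obtained by
  mapping and appending lists.  Where one list is longer, its
  surplus entries are ignored, which spares most of the lemmas a hypothesis on lengths.
\<close>

fun lincomb :: "('a, 'm) module \<Rightarrow> 'a list \<Rightarrow> 'm list \<Rightarrow> 'm" where
  "lincomb M (x # xs) (g # gs) = x \<odot>\<^bsub>M\<^esub> g \<oplus>\<^bsub>M\<^esub> lincomb M xs gs"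
| "lincomb M _ _ = \<zero>\<^bsub>M\<^esub>"

definition fin_gen :: "('a, 'x) ring_scheme \<Rightarrow> ('a, 'm) module \<Rightarrow> 'm set \<Rightarrow> bool" where
  "fin_gen A M S \<longleftrightarrow> (\<exists>gs. set gs \<subseteq> S \<and>
    (\<forall>x\<in>S. \<exists>cs. set cs \<subseteq> carrier A \<and> length cs = length gs \<and> x = lincomb M cs gs))"

lemma lincomb_closed:
  assumes "submod A M S" and "set cs \<subseteq> carrier A" and "set gs \<subseteq> S"
  shows "lincomb M cs gs \<in> S"
  using assms(2,3)
proof (induction cs arbitrary: gs)
  case (Cons c cs)
  then show ?case using assms(1) by (cases gs) (auto simp: submod_def)
qed (use assms(1) in \<open>auto simp: submod_def\<close>)

lemma lincomb_lin:
  assumes "left_module A M" and "left_module A N" and "lin A M N h"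
    and "set cs \<subseteq> carrier A" and "set gs \<subseteq> carrier M"
  shows "h (lincomb M cs gs) = lincomb N cs (map h gs)"
  using assms(4,5)
proof (induction cs arbitrary: gs)
  case (Cons c cs)
  interpret M: left_module A M by fact
  show ?case
    using Cons lin_zero[OF assms(1-3)] lincomb_closed[OF submod_carrier[OF assms(1)]]
    by (cases gs) (auto simp: lin_add[OF assms(3)] lin_smult[OF assms(3)] M.smult_closed)
qed (simp add: lin_zero[OF assms(1-3)])

lemma lincomb_append:
  assumes "left_module A M" and "length cs = length gs" and "set cs \<subseteq> carrier A"
    and "set gs \<subseteq> carrier M" and "set ds \<subseteq> carrier A" and "set hs \<subseteq> carrier M"
  shows "lincomb M (cs @ ds) (gs @ hs) = lincomb M cs gs \<oplus>\<^bsub>M\<^esub> lincomb M ds hs"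
proof -
  interpret M: left_module A M by fact
  note cl = lincomb_closed[OF submod_carrier[OF assms(1)]]
  show ?thesis
    using assms(2-4)
    by (induction cs gs rule: list_induct2) (use assms(5,6) cl in \<open>auto simp: M.smult_closed M.M.a_assoc\<close>)
qed

lemma lincomb_add:
  assumes "left_module A M" and "length cs = length ds" and "length ds = length gs"
    and "set cs \<subseteq> carrier A" and "set ds \<subseteq> carrier A" and "set gs \<subseteq> carrier M"
  shows "lincomb M (map2 (\<oplus>\<^bsub>A\<^esub>) cs ds) gs = lincomb M cs gs \<oplus>\<^bsub>M\<^esub> lincomb M ds gs"
proof -
  interpret M: left_module A M by fact
  note cl = lincomb_closed[OF submod_carrier[OF assms(1)]]
  show ?thesis
    using assms(2-6)
    by (induction cs ds gs rule: list_induct3)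
      (use cl in \<open>auto simp: M.smult_closed M.smult_l_distr M.M.a_ac\<close>)
qed

lemma lincomb_smult:
  assumes "left_module A M" and "a \<in> carrier A" and "set cs \<subseteq> carrier A" and "set gs \<subseteq> carrier M"
  shows "lincomb M (map (\<lambda>c. a \<otimes>\<^bsub>A\<^esub> c) cs) gs = a \<odot>\<^bsub>M\<^esub> lincomb M cs gs"
  using assms(3,4)
proof (induction cs arbitrary: gs)
  case (Cons c cs)
  interpret M: left_module A M by fact
  show ?case
    using Cons assms(2) lincomb_closed[OF submod_carrier[OF assms(1)]]
    by (cases gs) (auto simp: smult_zero_right[OF assms(1)] M.smult_assoc M.smult_r_distr M.smult_closed)
qed (simp add: smult_zero_right[OF assms(1,2)])

lemma lincomb_carrier_update [simp]: "lincomb (M\<lparr>carrier := S\<rparr>) cs gs = lincomb M cs gs"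
  by (induction M cs gs rule: lincomb.induct) auto

lemma fin_gen_carrier_update [simp]: "fin_gen A (M\<lparr>carrier := S\<rparr>) T = fin_gen A M T"
  by (simp add: fin_gen_def)

lemma fin_gen_image:
  assumes "left_module A M" and "left_module A N" and "lin A M N h"
    and "S \<subseteq> carrier M" and "fin_gen A M S"
  shows "fin_gen A N (h ` S)"
proof -
  obtain gs where gs: "set gs \<subseteq> S"
    "\<And>x. x \<in> S \<Longrightarrow> \<exists>cs. set cs \<subseteq> carrier A \<and> length cs = length gs \<and> x = lincomb M cs gs"
    using assms(5) by (auto simp: fin_gen_def)
  show ?thesis
    unfolding fin_gen_def
  proof (intro exI[of _ "map h gs"] conjI ballI)
    fix y assume "y \<in> h ` S"
    then obtain x where "x \<in> S" "y = h x" by auto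
    with gs(2) obtain cs where "set cs \<subseteq> carrier A" "length cs = length gs" "x = lincomb M cs gs"
      by blast
    then show "\<exists>cs. set cs \<subseteq> carrier A \<and> length cs = length (map h gs) \<and> y = lincomb N cs (map h gs)"
      using lincomb_lin[OF assms(1-3), of cs gs] gs(1) assms(4) \<open>y = h x\<close> by auto
  qed (use gs in auto)
qed

text \<open>
  The middle term of a short exact sequence is finitely generated if the outer terms are: lift
  generators of the image and append generators of the kernel.  This drives the
  finiteness results below, with \<open>h\<close> a coordinate projection or the
  multiplication by a ring element.
\<close>

lemma fin_gen_extension:
  assumes M: "left_module A M" and N: "left_module A N" and S: "submod A M S"
    and h: "lin A M N h"
    and im: "fin_gen A N (h ` S)" and ker: "fin_gen A M {x \<in> S. h x = \<zero>\<^bsub>N\<^esub>}"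
  shows "fin_gen A M S"
proof -
  interpret M: left_module A M by fact
  interpret N: left_module A N by fact
  have SM: "S \<subseteq> carrier M" using S by (simp add: submod_def)
  obtain ks where ks: "set ks \<subseteq> h ` S"
    "\<And>y. y \<in> h ` S \<Longrightarrow> \<exists>cs. set cs \<subseteq> carrier A \<and> length cs = length ks \<and> y = lincomb N cs ks"
    using im by (auto simp: fin_gen_def)
  obtain hs where hs: "set hs \<subseteq> {x \<in> S. h x = \<zero>\<^bsub>N\<^esub>}"
    "\<And>y. y \<in> {x \<in> S. h x = \<zero>\<^bsub>N\<^esub>} \<Longrightarrow>
      \<exists>cs. set cs \<subseteq> carrier A \<and> length cs = length hs \<and> y = lincomb M cs hs"
    using ker by (auto simp: fin_gen_def)
  define gs where "gs = map (inv_into S h) ks"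
  have gs: "set gs \<subseteq> S" using ks(1) by (auto simp: gs_def inv_into_into)
  have hgs: "map h gs = ks"
    using ks(1) by (auto simp: gs_def f_inv_into_f subset_iff intro!: map_idI)
  show ?thesis
    unfolding fin_gen_def
  proof (intro exI[of _ "gs @ hs"] conjI ballI)
    show "set (gs @ hs) \<subseteq> S" using gs hs(1) by auto
    fix x assume x: "x \<in> S"
    then obtain cs where cs: "set cs \<subseteq> carrier A" "length cs = length ks" "h x = lincomb N cs ks"
      using ks(2) by blast
    have lS: "lincomb M cs gs \<in> S" by (rule lincomb_closed[OF S cs(1) gs])
    have "h (lincomb M cs gs) = h x"
      using lincomb_lin[OF M N h cs(1), of gs] gs SM hgs cs(3) by auto
    then have "h (x \<ominus>\<^bsub>M\<^esub> lincomb M cs gs) = \<zero>\<^bsub>N\<^esub>"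
      using x lS SM lin_closed[OF h]
      by (subst lin_diff[OF M N h]) (auto simp: N.M.diff_eq_zero_iff)
    then obtain ds where ds: "set ds \<subseteq> carrier A" "length ds = length hs"
      "x \<ominus>\<^bsub>M\<^esub> lincomb M cs gs = lincomb M ds hs"
      using hs(2) submod_diff[OF M S x lS] by blast
    have "lincomb M (cs @ ds) (gs @ hs) = lincomb M cs gs \<oplus>\<^bsub>M\<^esub> lincomb M ds hs"
      using cs ds gs hs(1) SM hgs[symmetric] by (intro lincomb_append[OF M]) auto
    also have "\<dots> = x"
      using x lS SM by (simp add: ds(3)[symmetric] a_minus_def M.M.a_ac M.M.r_neg subset_iff)
    finally show "\<exists>cs. set cs \<subseteq> carrier A \<and> length cs = length (gs @ hs) \<and> x = lincomb M cs (gs @ hs)"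
      using cs ds by (intro exI[of _ "cs @ ds"]) (auto simp: gs_def)
  qed
qed

text \<open>
  For the converse, the set of all sums over the underlying set of the list is
  a submodule containing the generators, so it contains all linear combinations of the list; this avoids
  collecting the coefficients of equal generators.
\<close>

lemma finitely_generated_iff_fin_gen:
  assumes M: "left_module A M"
  shows "finitely_generated A M \<longleftrightarrow> fin_gen A M (carrier M)"
proof
  interpret M: left_module A M by fact
  { assume "finitely_generated A M"
    then obtain G where G: "finite G" "G \<subseteq> carrier M"
      "\<And>x. x \<in> carrier M \<Longrightarrow> \<exists>c \<in> G \<rightarrow> carrier A. x = (\<Oplus>\<^bsub>M\<^esub>g\<in>G. c g \<odot>\<^bsub>M\<^esub> g)"
      by (auto simp: finitely_generated_def)
    obtain gs where gs: "set gs = G" "distinct gs" using G(1) finite_distinct_list by blast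
    have *: "(\<Oplus>\<^bsub>M\<^esub>g\<in>set gs. c g \<odot>\<^bsub>M\<^esub> g) = lincomb M (map c gs) gs"
      if "c \<in> set gs \<rightarrow> carrier A" "set gs \<subseteq> carrier M" "distinct gs" for c gs
      using that
    proof (induction gs)
      case (Cons g gs)
      then have "(\<lambda>g. c g \<odot>\<^bsub>M\<^esub> g) \<in> set gs \<rightarrow> carrier M" "c g \<odot>\<^bsub>M\<^esub> g \<in> carrier M"
        by (auto simp: M.smult_closed Pi_iff)
      then show ?case using Cons by (simp add: M.M.finsum_insert)
    qed simp
    show "fin_gen A M (carrier M)"
      unfolding fin_gen_def
    proof (intro exI[of _ gs] conjI ballI)
      fix x assume "x \<in> carrier M"
      then obtain c where "c \<in> G \<rightarrow> carrier A" "x = (\<Oplus>\<^bsub>M\<^esub>g\<in>G. c g \<odot>\<^bsub>M\<^esub> g)" using G(3) by blast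
      then show "\<exists>cs. set cs \<subseteq> carrier A \<and> length cs = length gs \<and> x = lincomb M cs gs"
        using *[of c gs] gs G(2) by (intro exI[of _ "map c gs"]) auto
    qed (use gs G in auto) }
  { assume "fin_gen A M (carrier M)"
    then obtain gs where gs: "set gs \<subseteq> carrier M"
      "\<And>x. x \<in> carrier M \<Longrightarrow> \<exists>cs. set cs \<subseteq> carrier A \<and> length cs = length gs \<and> x = lincomb M cs gs"
      by (auto simp: fin_gen_def)
    define S where "S = {\<Oplus>\<^bsub>M\<^esub>g\<in>set gs. c g \<odot>\<^bsub>M\<^esub> g |c. c \<in> set gs \<rightarrow> carrier A}"
    have cl: "(\<lambda>g. c g \<odot>\<^bsub>M\<^esub> g) \<in> G \<rightarrow> carrier M"
      if "c \<in> G \<rightarrow> carrier A" "G \<subseteq> carrier M" for c G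
      using that by (auto simp: M.smult_closed Pi_iff)
    have scal: "a \<odot>\<^bsub>M\<^esub> (\<Oplus>\<^bsub>M\<^esub>g\<in>G. c g \<odot>\<^bsub>M\<^esub> g) = (\<Oplus>\<^bsub>M\<^esub>g\<in>G. (a \<otimes>\<^bsub>A\<^esub> c g) \<odot>\<^bsub>M\<^esub> g)"
      if "finite G" "a \<in> carrier A" "c \<in> G \<rightarrow> carrier A" "G \<subseteq> carrier M" for a c G
      using that
    proof (induction G)
      case (insert g G)
      then have *: "(\<lambda>g. c g \<odot>\<^bsub>M\<^esub> g) \<in> G \<rightarrow> carrier M" "c g \<odot>\<^bsub>M\<^esub> g \<in> carrier M"
        "(\<lambda>g. (a \<otimes>\<^bsub>A\<^esub> c g) \<odot>\<^bsub>M\<^esub> g) \<in> G \<rightarrow> carrier M" "(a \<otimes>\<^bsub>A\<^esub> c g) \<odot>\<^bsub>M\<^esub> g \<in> carrier M"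
        by (auto simp: M.smult_closed Pi_iff)
      show ?case
        using insert M.M.finsum_closed[OF *(1)]
        by (simp add: M.M.finsum_insert[OF _ _ *(1,2)] M.M.finsum_insert[OF _ _ *(3,4)] * M.smult_r_distr)
          (simp add: M.smult_assoc)
    qed (simp add: smult_zero_right[OF M])
    have "submod A M S"
      unfolding submod_def
    proof (intro conjI ballI)
      show "S \<subseteq> carrier M" using cl gs(1) by (auto simp: S_def intro!: M.M.finsum_closed)
      have "(\<Oplus>\<^bsub>M\<^esub>g\<in>set gs. \<zero>\<^bsub>A\<^esub> \<odot>\<^bsub>M\<^esub> g) = (\<Oplus>\<^bsub>M\<^esub>g\<in>set gs. \<zero>\<^bsub>M\<^esub>)"
        using gs(1) by (intro M.M.finsum_cong') (auto simp: smult_zero_left[OF M])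
      then show "\<zero>\<^bsub>M\<^esub> \<in> S"
        unfolding S_def by (auto intro!: exI[of _ "\<lambda>g. \<zero>\<^bsub>A\<^esub>"])
      fix x assume "x \<in> S"
      then obtain c where c: "c \<in> set gs \<rightarrow> carrier A" "x = (\<Oplus>\<^bsub>M\<^esub>g\<in>set gs. c g \<odot>\<^bsub>M\<^esub> g)"
        by (auto simp: S_def)
      { fix y assume "y \<in> S"
        then obtain d where d: "d \<in> set gs \<rightarrow> carrier A" "y = (\<Oplus>\<^bsub>M\<^esub>g\<in>set gs. d g \<odot>\<^bsub>M\<^esub> g)"
          by (auto simp: S_def)
        have "x \<oplus>\<^bsub>M\<^esub> y = (\<Oplus>\<^bsub>M\<^esub>g\<in>set gs. c g \<odot>\<^bsub>M\<^esub> g \<oplus>\<^bsub>M\<^esub> d g \<odot>\<^bsub>M\<^esub> g)"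
          using cl[OF c(1) gs(1)] cl[OF d(1) gs(1)] c d by (simp add: M.M.finsum_addf)
        also have "\<dots> = (\<Oplus>\<^bsub>M\<^esub>g\<in>set gs. (c g \<oplus>\<^bsub>A\<^esub> d g) \<odot>\<^bsub>M\<^esub> g)"
          using c(1) d(1) gs(1)
          by (intro M.M.finsum_cong') (auto simp: M.smult_l_distr M.smult_closed Pi_iff subset_iff)
        finally show "x \<oplus>\<^bsub>M\<^esub> y \<in> S"
          using c d by (auto simp: S_def intro!: exI[of _ "\<lambda>g. c g \<oplus>\<^bsub>A\<^esub> d g"]) }
      { fix a assume a: "a \<in> carrier A"
        then show "a \<odot>\<^bsub>M\<^esub> x \<in> S"
          using scal[OF _ a c(1) gs(1)] c
          by (auto simp: S_def intro!: exI[of _ "\<lambda>g. a \<otimes>\<^bsub>A\<^esub> c g"]) }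
    qed
    moreover have "set gs \<subseteq> S"
    proof
      fix h assume h: "h \<in> set gs"
      have "(\<Oplus>\<^bsub>M\<^esub>g\<in>set gs. (if h = g then \<one>\<^bsub>A\<^esub> else \<zero>\<^bsub>A\<^esub>) \<odot>\<^bsub>M\<^esub> g)
          = (\<Oplus>\<^bsub>M\<^esub>g\<in>set gs. if h = g then g else \<zero>\<^bsub>M\<^esub>)"
        using gs(1) by (intro M.M.finsum_cong') (auto simp: smult_zero_left[OF M] M.smult_one)
      also have "\<dots> = h"
        using gs(1) h by (intro M.M.add.finprod_singleton) auto
      finally show "h \<in> S"
        by (auto simp: S_def intro!: exI[of _ "\<lambda>g. if h = g then \<one>\<^bsub>A\<^esub> else \<zero>\<^bsub>A\<^esub>"])
    qed
    ultimately have "x \<in> S" if "x \<in> carrier M" for x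
      using gs(2)[OF that] lincomb_closed by blast
    then show "finitely_generated A M"
      unfolding finitely_generated_def S_def
      using gs(1) by (intro exI[of _ "set gs"]) auto }
qed

section \<open>Free modules\<close>

text \<open>
  The free module of rank \<open>n\<close>, with the coordinate tuples as elements.  Lists over the
  ring are used because the universe of modules is only known to contain a copy of
  \<^typ>\<open>'a list\<close>.  The fields \<^const>\<open>monoid.mult\<close> and \<^const>\<open>one\<close> of the record are filled with
  arbitrary values.
\<close>

definition list_module :: "('a, 'x) ring_scheme \<Rightarrow> nat \<Rightarrow> ('a, 'a list) module" where
  "list_module A n =
    \<lparr>carrier = {xs. set xs \<subseteq> carrier A \<and> length xs = n}, mult = (\<lambda>xs ys. xs), one = [],
     zero = replicate n \<zero>\<^bsub>A\<^esub>, add = map2 (\<oplus>\<^bsub>A\<^esub>), smult = (\<lambda>a. map (\<lambda>x. a \<otimes>\<^bsub>A\<^esub> x))\<rparr>"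

lemma list_module_simps [simp]:
  "carrier (list_module A n) = {xs. set xs \<subseteq> carrier A \<and> length xs = n}"
  "\<zero>\<^bsub>list_module A n\<^esub> = replicate n \<zero>\<^bsub>A\<^esub>"
  "xs \<oplus>\<^bsub>list_module A n\<^esub> ys = map2 (\<oplus>\<^bsub>A\<^esub>) xs ys"
  "a \<odot>\<^bsub>list_module A n\<^esub> xs = map (\<lambda>x. a \<otimes>\<^bsub>A\<^esub> x) xs"
  by (simp_all add: list_module_def)

lemma left_module_list_module:
  assumes "ring A"
  shows "left_module A (list_module A n)"
proof -
  interpret A: ring A by fact
  have nth: "xs ! i \<in> carrier A" if "set xs \<subseteq> carrier A" "i < length xs" for xs i
    using that by (meson nth_mem subsetD)
  have "abelian_group (list_module A n)"
  proof (rule abelian_groupI)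
    fix xs assume "xs \<in> carrier (list_module A n)"
    then show "\<exists>ys\<in>carrier (list_module A n). ys \<oplus>\<^bsub>list_module A n\<^esub> xs = \<zero>\<^bsub>list_module A n\<^esub>"
      by (intro bexI[of _ "map (\<lambda>x. \<ominus>\<^bsub>A\<^esub> x) xs"])
        (auto simp: A.l_neg nth intro!: nth_equalityI)
  qed (auto simp: nth A.a_ac in_set_zip intro!: nth_equalityI)
  then show ?thesis
    by (intro left_module.intro left_module_axioms.intro assms)
      (auto simp: nth A.l_distr A.r_distr A.m_assoc in_set_zip intro!: nth_equalityI map_idI)
qed

lemma lin_lincomb:
  assumes "left_module A M" and "set gs \<subseteq> carrier M"
  shows "lin A (list_module A (length gs)) M (\<lambda>xs. lincomb M xs gs)"
proof -
  interpret M: left_module A M by fact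
  show ?thesis
  proof (rule linI)
    fix xs assume "xs \<in> carrier (list_module A (length gs))"
    then show "lincomb M xs gs \<in> carrier M"
      using lincomb_closed[OF submod_carrier[OF assms(1)]] assms(2) by auto
  qed (use assms(2) in \<open>auto simp: lincomb_add[OF assms(1)] lincomb_smult[OF assms(1)]\<close>)
qed

text \<open>
  A linear map on a free module is determined by arbitrary images \<open>ms\<close> of the
  basis.  Induction on the rank peels off one coordinate at a time, so the basis vectors never have to be
  handled explicitly.
\<close>

lemma lin_list_module_eq_lincomb:
  assumes A: "ring A" and Z: "left_module A Z" and h: "lin A (list_module A n) Z h"
  obtains ms where "set ms \<subseteq> carrier Z" and "length ms = n"
    and "\<And>xs. set xs \<subseteq> carrier A \<Longrightarrow> length xs = n \<Longrightarrow> h xs = lincomb Z xs ms"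
proof -
  interpret A: ring A by fact
  interpret Z: left_module A Z by fact
  have zeros: "map2 (\<oplus>\<^bsub>A\<^esub>) (replicate (length xs) \<zero>\<^bsub>A\<^esub>) xs = xs" if "set xs \<subseteq> carrier A" for xs
    using that by (induction xs) auto
  have "\<exists>ms. set ms \<subseteq> carrier Z \<and> length ms = n \<and>
      (\<forall>xs. set xs \<subseteq> carrier A \<longrightarrow> length xs = n \<longrightarrow> h xs = lincomb Z xs ms)"
    using h
  proof (induction n arbitrary: h)
    case 0
    show ?case
      using lin_zero[OF left_module_list_module[OF A] Z 0] by (intro exI[of _ "[]"]) auto
  next
    case (Suc n)
    have "lin A (list_module A n) Z (\<lambda>xs. h (\<zero>\<^bsub>A\<^esub> # xs))"
    proof (rule linI)
      fix xs ys assume "xs \<in> carrier (list_module A n)" "ys \<in> carrier (list_module A n)"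
      then show "h (\<zero>\<^bsub>A\<^esub> # (xs \<oplus>\<^bsub>list_module A n\<^esub> ys)) = h (\<zero>\<^bsub>A\<^esub> # xs) \<oplus>\<^bsub>Z\<^esub> h (\<zero>\<^bsub>A\<^esub> # ys)"
        using lin_add[OF Suc.prems, of "\<zero>\<^bsub>A\<^esub> # xs" "\<zero>\<^bsub>A\<^esub> # ys"] by simp
    next
      fix a xs assume "a \<in> carrier A" "xs \<in> carrier (list_module A n)"
      then show "h (\<zero>\<^bsub>A\<^esub> # (a \<odot>\<^bsub>list_module A n\<^esub> xs)) = a \<odot>\<^bsub>Z\<^esub> h (\<zero>\<^bsub>A\<^esub> # xs)"
        using lin_smult[OF Suc.prems, of a "\<zero>\<^bsub>A\<^esub> # xs"] by simp
    qed (use lin_closed[OF Suc.prems] in simp)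
    from Suc.IH[OF this] obtain ms where ms: "set ms \<subseteq> carrier Z" "length ms = n"
      "\<And>xs. set xs \<subseteq> carrier A \<Longrightarrow> length xs = n \<Longrightarrow> h (\<zero>\<^bsub>A\<^esub> # xs) = lincomb Z xs ms"
      by blast
    define m where "m = h (\<one>\<^bsub>A\<^esub> # replicate n \<zero>\<^bsub>A\<^esub>)"
    have e: "\<one>\<^bsub>A\<^esub> # replicate n \<zero>\<^bsub>A\<^esub> \<in> carrier (list_module A (Suc n))" by auto
    have "h xs = lincomb Z xs (m # ms)" if xs: "set xs \<subseteq> carrier A" "length xs = Suc n" for xs
    proof -
      obtain y ys where y: "xs = y # ys" using xs(2) by (cases xs) auto
      have "h xs = h ((y \<odot>\<^bsub>list_module A (Suc n)\<^esub> (\<one>\<^bsub>A\<^esub> # replicate n \<zero>\<^bsub>A\<^esub>))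
          \<oplus>\<^bsub>list_module A (Suc n)\<^esub> (\<zero>\<^bsub>A\<^esub> # ys))"
        using xs y zeros[of ys] by simp
      also have "\<dots> = y \<odot>\<^bsub>Z\<^esub> m \<oplus>\<^bsub>Z\<^esub> h (\<zero>\<^bsub>A\<^esub> # ys)"
        using xs y lin_smult[OF Suc.prems _ e, of y]
        by (subst lin_add[OF Suc.prems]) (auto simp: m_def)
      finally show ?thesis using xs y ms(3)[of ys] by simp
    qed
    then show ?case
      using ms(1,2) lin_closed[OF Suc.prems e] by (intro exI[of _ "m # ms"]) (auto simp: m_def)
  qed
  then show ?thesis using that by blast
qed

text \<open>
  Projectivity of free modules, with the target of \<open>h\<close> only required to lie in the
  image of \<open>g\<close> and with all modules over arbitrary types: lift the images of the basis.
\<close>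

lemma list_module_lift:
  assumes A: "ring A" and Y: "left_module A Y" and Z: "left_module A Z"
    and g: "lin A Y Z g" and h: "lin A (list_module A n) Z h"
    and im: "h ` carrier (list_module A n) \<subseteq> g ` carrier Y"
  obtains k where "lin A (list_module A n) Y k"
    and "\<And>xs. xs \<in> carrier (list_module A n) \<Longrightarrow> g (k xs) = h xs"
proof -
  let ?T = "g ` carrier Y"
  have T: "submod A Z ?T" by (rule submod_image[OF Y Z g submod_carrier[OF Y]])
  have "lin A (list_module A n) (Z\<lparr>carrier := ?T\<rparr>) h"
    using h im by (auto simp: lin_def)
  from lin_list_module_eq_lincomb[OF A left_module_submod[OF Z T] this]
  obtain ms where ms: "set ms \<subseteq> ?T" "length ms = n"
    "\<And>xs. set xs \<subseteq> carrier A \<Longrightarrow> length xs = n \<Longrightarrow> h xs = lincomb Z xs ms"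
    by (metis lincomb_carrier_update partial_object.select_convs(1) partial_object.update_convs(1)
        partial_object.surjective)
  define ks where "ks = map (inv_into (carrier Y) g) ms"
  have ks: "set ks \<subseteq> carrier Y" using ms(1) by (auto simp: ks_def inv_into_into)
  have gks: "map g ks = ms"
    using ms(1) by (auto simp: ks_def f_inv_into_f subset_iff intro!: map_idI)
  have len: "length ks = n" using ms(2) by (simp add: ks_def)
  show ?thesis
  proof (rule that)
    show "lin A (list_module A n) Y (\<lambda>xs. lincomb Y xs ks)"
      using lin_lincomb[OF Y ks] len by simp
    fix xs assume "xs \<in> carrier (list_module A n)"
    then show "g (lincomb Y xs ks) = h xs"
      using lincomb_lin[OF Y Z g _ ks, of xs] ms(3) gks by simp
  qed
qed

lemma list_module_fin_gen:
  assumes "ring A"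
  shows "fin_gen A (list_module A n) (carrier (list_module A n))"
proof -
  note L = left_module_list_module[OF assms]
  obtain ms where "set ms \<subseteq> carrier (list_module A n)" "length ms = n"
    "\<And>xs. set xs \<subseteq> carrier A \<Longrightarrow> length xs = n \<Longrightarrow> xs = lincomb (list_module A n) xs ms"
    using lin_list_module_eq_lincomb[OF assms L lin_id] by metis
  then show ?thesis unfolding fin_gen_def by (intro exI[of _ ms]) auto
qed

lemma list_module_cover:
  assumes "left_module A M" and "fin_gen A M (carrier M)"
  obtains n p where "lin A (list_module A n) M p" and "p ` carrier (list_module A n) = carrier M"
proof -
  obtain gs where gs: "set gs \<subseteq> carrier M"
    "\<And>x. x \<in> carrier M \<Longrightarrow> \<exists>cs. set cs \<subseteq> carrier A \<and> length cs = length gs \<and> x = lincomb M cs gs"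
    using assms(2) by (auto simp: fin_gen_def)
  have "(\<lambda>xs. lincomb M xs gs) ` carrier (list_module A (length gs)) = carrier M"
  proof (intro equalityI subsetI)
    fix x assume "x \<in> carrier M"
    then show "x \<in> (\<lambda>xs. lincomb M xs gs) ` carrier (list_module A (length gs))"
      using gs(2)[of x] by auto
  qed (use lincomb_closed[OF submod_carrier[OF assms(1)] _ gs(1)] in auto)
  then show ?thesis using that lin_lincomb[OF assms(1) gs(1)] by blast
qed

lemma regular_module_simps [simp]:
  "carrier (regular_module A) = carrier A" "\<zero>\<^bsub>regular_module A\<^esub> = \<zero>\<^bsub>A\<^esub>"
  "x \<oplus>\<^bsub>regular_module A\<^esub> y = x \<oplus>\<^bsub>A\<^esub> y" "a \<odot>\<^bsub>regular_module A\<^esub> x = a \<otimes>\<^bsub>A\<^esub> x"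
  by (simp_all add: regular_module_def)

lemma left_module_regular:
  assumes "ring A"
  shows "left_module A (regular_module A)"
proof -
  interpret A: ring A by fact
  have "abelian_group (regular_module A)"
    by (rule abelian_groupI) (auto simp: A.a_ac intro: A.l_neg)
  then show ?thesis
    by (intro left_module.intro left_module_axioms.intro assms)
      (auto simp: A.l_distr A.r_distr A.m_assoc)
qed

lemma list_module_1_bij:
  shows "lin A (list_module A 1) (regular_module A) hd"
    and "bij_betw hd (carrier (list_module A 1)) (carrier (regular_module A))"
proof -
  show "lin A (list_module A 1) (regular_module A) hd"
    by (rule linI) (auto simp: length_Suc_conv)
  show "bij_betw hd (carrier (list_module A 1)) (carrier (regular_module A))"
    by (rule bij_betw_byWitness[where f' = "\<lambda>x. [x]"]) (auto simp: length_Suc_conv)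
qed


section \<open>Projective modules\<close>

lemma projective_left_module: "projective_module A P \<Longrightarrow> left_module A P"
  by (simp add: projective_module_def)

text \<open>
  The lifting property in the form in which it is used to construct chain maps:
  \<open>g\<close> need not be surjective, since its image is itself a module in the same universe.
\<close>

lemma projective_lift:
  fixes P Y N :: "('a, 'm) module"
  assumes P: "projective_module A P" and Y: "left_module A Y" and N: "left_module A N"
    and g: "lin A Y N g" and h: "lin A P N h" and im: "h ` carrier P \<subseteq> g ` carrier Y"
  obtains k where "lin A P Y k" and "\<And>x. x \<in> carrier P \<Longrightarrow> g (k x) = h x"
proof -
  have PP: "left_module A P" using P by (rule projective_left_module)
  let ?Z = "N\<lparr>carrier := g ` carrier Y\<rparr>"
  have Z: "left_module A ?Z"
    by (rule left_module_submod[OF N submod_image[OF Y N g submod_carrier[OF Y]]])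
  have "lin A Y ?Z g" "lin A P ?Z h" using g h im by (auto simp: lin_def)
  then have g': "restrict g (carrier Y) \<in> mod_hom A Y ?Z" and h': "restrict h (carrier P) \<in> mod_hom A P ?Z"
    using restrict_mod_hom Y PP by blast+
  have "restrict g (carrier Y) ` carrier Y = carrier ?Z" by auto
  with P g' h' Y Z obtain k where k: "k \<in> mod_hom A P Y"
    "compose (carrier P) (restrict g (carrier Y)) k = restrict h (carrier P)"
    unfolding projective_module_def by blast
  show ?thesis
  proof (rule that)
    show lk: "lin A P Y k" using k(1) by (rule mod_hom_lin)
    fix x assume x: "x \<in> carrier P"
    then show "g (k x) = h x"
      using fun_cong[OF k(2), of x] lin_closed[OF lk x] by (simp add: compose_def)
  qed
qed

lemma projective_moduleI:
  fixes P :: "('a, 'm) module"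
  assumes P: "left_module A P"
    and lift: "\<And>(Y :: ('a, 'm) module) (Z :: ('a, 'm) module) g h.
      left_module A Y \<Longrightarrow> left_module A Z \<Longrightarrow> lin A Y Z g \<Longrightarrow> lin A P Z h \<Longrightarrow>
      g ` carrier Y = carrier Z \<Longrightarrow> \<exists>k. lin A P Y k \<and> (\<forall>x\<in>carrier P. g (k x) = h x)"
  shows "projective_module A P"
  unfolding projective_module_def
proof (intro conjI allI ballI impI P)
  fix Y Z :: "('a, 'm) module" and g h
  assume gh: "g \<in> mod_hom A Y Z" "h \<in> mod_hom A P Z"
    and YZ: "left_module A Y" "left_module A Z" "g ` carrier Y = carrier Z"
  obtain k where k: "lin A P Y k" "\<forall>x\<in>carrier P. g (k x) = h x"
    using lift[OF YZ(1,2) mod_hom_lin[OF gh(1)] mod_hom_lin[OF gh(2)] YZ(3)] by auto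
  show "\<exists>k\<in>mod_hom A P Y. compose (carrier P) g k = h"
  proof (intro bexI)
    show "restrict k (carrier P) \<in> mod_hom A P Y" by (rule restrict_mod_hom[OF P k(1)])
    have "h \<in> extensional (carrier P)" using gh(2) by (simp add: mod_hom_iff)
    then show "compose (carrier P) g (restrict k (carrier P)) = h"
      using k(2) by (intro ext) (auto simp: compose_def extensional_def)
  qed
qed

lemma projective_copy_of_list_module:
  fixes P :: "('a, 'm) module"
  assumes A: "ring A" and P: "left_module A P"
    and t: "lin A (list_module A n) P t" "bij_betw t (carrier (list_module A n)) (carrier P)"
  shows "projective_module A P"
proof (rule projective_moduleI[OF P])
  note L = left_module_list_module[OF A]
  fix Y Z :: "('a, 'm) module" and g h
  assume Y: "left_module A Y" and Z: "left_module A Z" and g: "lin A Y Z g" and h: "lin A P Z h"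
    and surj: "g ` carrier Y = carrier Z"
  have ht: "lin A (list_module A n) Z (\<lambda>xs. h (t xs))" by (rule lin_comp[OF t(1) h])
  then have "(\<lambda>xs. h (t xs)) ` carrier (list_module A n) \<subseteq> g ` carrier Y"
    using surj lin_closed[OF ht] by blast
  from list_module_lift[OF A Y Z g ht this] obtain k where k: "lin A (list_module A n) Y k"
    "\<And>xs. xs \<in> carrier (list_module A n) \<Longrightarrow> g (k xs) = h (t xs)" by blast
  let ?s = "inv_into (carrier (list_module A n)) t"
  have s: "?s x \<in> carrier (list_module A n)" "t (?s x) = x" if "x \<in> carrier P" for x
    using t(2) that by (auto simp only: bij_betw_def inv_into_into f_inv_into_f)
  show "\<exists>k. lin A P Y k \<and> (\<forall>x\<in>carrier P. g (k x) = h x)"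
    using lin_comp[OF lin_inv_into[OF L t] k(1)] k(2) s
    by (intro exI[of _ "\<lambda>x. k (?s x)"]) (simp del: list_module_simps)
qed

text \<open>
  Projectivity refers to the universe \<^typ>\<open>'m\<close>, whereas free modules are built on lists; the
  free modules are therefore replaced by isomorphic copies in \<^typ>\<open>'m\<close>.
\<close>

lemma free_module_exists:
  fixes \<iota> :: "'a list \<Rightarrow> 'm"
  assumes A: "ring A" and "inj \<iota>"
  obtains P :: "('a, 'm) module" and t where "P \<in> fg_modules A" and "projective_module A P"
    and "lin A (list_module A n) P t" and "bij_betw t (carrier (list_module A n)) (carrier P)"
proof -
  have "list_module A n \<in> fg_modules A"
    using left_module_list_module[OF A] list_module_fin_gen[OF A]
    by (simp add: fg_modules_def finitely_generated_iff_fin_gen del: list_module_simps)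
  then obtain P :: "('a, 'm) module" and t where P: "P \<in> fg_modules A"
    "t \<in> mod_hom A (list_module A n) P" "bij_betw t (carrier (list_module A n)) (carrier P)"
    using fg_module_isomorphic_copy[OF assms(2)] unfolding mod_isomorphic_def by blast
  have "left_module A P" using P(1) by (simp add: fg_modules_def)
  then have "projective_module A P"
    by (rule projective_copy_of_list_module[OF A _ mod_hom_lin[OF P(2)] P(3)])
  then show ?thesis using that P mod_hom_lin by blast
qed

lemma regular_module_copy:
  fixes \<iota> :: "'a list \<Rightarrow> 'm"
  assumes A: "ring A" and "inj \<iota>"
  obtains P :: "('a, 'm) module" and s where "P \<in> fg_modules A" and "projective_module A P"
    and "lin A P (regular_module A) s" and "bij_betw s (carrier P) (carrier (regular_module A))"
proof -
  obtain P :: "('a, 'm) module" and t where P: "P \<in> fg_modules A" "projective_module A P"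
    and t: "lin A (list_module A 1) P t" "bij_betw t (carrier (list_module A 1)) (carrier P)"
    using free_module_exists[OF A assms(2)] .
  let ?u = "inv_into (carrier (list_module A 1)) t"
  have "lin A P (regular_module A) (\<lambda>x. hd (?u x))"
    by (rule lin_comp[OF lin_inv_into[OF left_module_list_module[OF A] t] list_module_1_bij(1)])
  moreover have "bij_betw (\<lambda>x. hd (?u x)) (carrier P) (carrier (regular_module A))"
    using bij_betw_trans[OF bij_betw_inv_into[OF t(2)] list_module_1_bij(2)] by (simp add: comp_def)
  ultimately show ?thesis using that P by blast
qed

lemma fg_projective_surjection:
  fixes \<iota> :: "'a list \<Rightarrow> 'm" and M :: "('a, 'm) module"
  assumes A: "ring A" and "inj \<iota>" and M: "M \<in> fg_modules A"
  obtains P :: "('a, 'm) module" and p where "P \<in> fg_modules A" and "projective_module A P"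
    and "lin A P M p" and "p ` carrier P = carrier M"
proof -
  have lm: "left_module A M" and fg: "fin_gen A M (carrier M)"
    using M by (auto simp: fg_modules_def finitely_generated_iff_fin_gen)
  obtain n q where q: "lin A (list_module A n) M q" "q ` carrier (list_module A n) = carrier M"
    using list_module_cover[OF lm fg] .
  obtain P :: "('a, 'm) module" and t where P: "P \<in> fg_modules A" "projective_module A P"
    and t: "lin A (list_module A n) P t" "bij_betw t (carrier (list_module A n)) (carrier P)"
    using free_module_exists[OF A assms(2)] .
  let ?s = "inv_into (carrier (list_module A n)) t"
  have "?s ` carrier P = carrier (list_module A n)"
    using bij_betw_inv_into[OF t(2)] by (simp add: bij_betw_def)
  then have "(\<lambda>x. q (?s x)) ` carrier P = carrier M"
    using q(2) by (metis image_image)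
  then show ?thesis
    using that P lin_comp[OF lin_inv_into[OF left_module_list_module[OF A] t] q(1)] by blast
qed

section \<open>Noetherian rings\<close>

definition left_noetherian :: "('a, 'x) ring_scheme \<Rightarrow> bool" where
  "left_noetherian A \<longleftrightarrow>
    (\<forall>I. submod A (regular_module A) I \<longrightarrow> fin_gen A (regular_module A) I)"

lemma fin_gen_zero: "fin_gen A M {\<zero>\<^bsub>M\<^esub>}"
  unfolding fin_gen_def by (intro exI[of _ "[]"]) auto

text \<open>
  Induction on the rank along the split sequence given by the first coordinate: the image of
  \<open>S\<close> is a left ideal, and the kernel is a submodule of the free module of smaller rank.
\<close>

lemma noetherian_list_module:
  assumes A: "ring A" and noeth: "left_noetherian A" and S: "submod A (list_module A n) S"
  shows "fin_gen A (list_module A n) S"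
  using S
proof (induction n arbitrary: S)
  case 0
  then have "S = {\<zero>\<^bsub>list_module A 0\<^esub>}" by (auto simp: submod_def)
  then show ?case using fin_gen_zero[of A "list_module A 0"] by simp
next
  case (Suc n)
  interpret A: ring A by fact
  let ?L = "list_module A n" and ?L' = "list_module A (Suc n)"
  note L = left_module_list_module[OF A, of n] and L' = left_module_list_module[OF A, of "Suc n"]
  have hd: "lin A ?L' (regular_module A) hd"
    by (rule linI) (auto simp: length_Suc_conv)
  have ins: "lin A ?L ?L' (\<lambda>xs. \<zero>\<^bsub>A\<^esub> # xs)"
    by (rule linI) auto
  let ?T = "{xs \<in> carrier ?L. \<zero>\<^bsub>A\<^esub> # xs \<in> S}"
  have "submod A ?L ?T" by (rule submod_vimage[OF L L' ins submod_carrier[OF L] Suc.prems])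
  then have "fin_gen A ?L' ((\<lambda>xs. \<zero>\<^bsub>A\<^esub> # xs) ` ?T)"
    using Suc.IH by (intro fin_gen_image[OF L L' ins]) auto
  moreover have "(\<lambda>xs. \<zero>\<^bsub>A\<^esub> # xs) ` ?T = {xs \<in> S. hd xs = \<zero>\<^bsub>regular_module A\<^esub>}"
  proof (intro equalityI subsetI)
    fix xs assume xs: "xs \<in> {xs \<in> S. hd xs = \<zero>\<^bsub>regular_module A\<^esub>}"
    then have "xs \<in> carrier ?L'" using Suc.prems by (auto simp only: submod_def)
    then show "xs \<in> (\<lambda>xs. \<zero>\<^bsub>A\<^esub> # xs) ` ?T" using xs by (cases xs) auto
  qed auto
  moreover have "fin_gen A (regular_module A) (hd ` S)"
    using noeth submod_image[OF L' left_module_regular[OF A] hd Suc.prems]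
    by (simp add: left_noetherian_def)
  ultimately show ?case
    using fin_gen_extension[OF L' left_module_regular[OF A] Suc.prems hd] by simp
qed

lemma noetherian_submodule:
  assumes A: "ring A" and noeth: "left_noetherian A"
    and M: "left_module A M" "fin_gen A M (carrier M)" and S: "submod A M S"
  shows "fin_gen A M S"
proof -
  obtain n p where p: "lin A (list_module A n) M p" "p ` carrier (list_module A n) = carrier M"
    using list_module_cover[OF M] .
  note L = left_module_list_module[OF A, of n]
  let ?T = "{xs \<in> carrier (list_module A n). p xs \<in> S}"
  have "submod A (list_module A n) ?T"
    by (rule submod_vimage[OF L M(1) p(1) submod_carrier[OF L] S])
  then have "fin_gen A M (p ` ?T)"
    by (intro fin_gen_image[OF L M(1) p(1)] noetherian_list_module[OF A noeth]) auto
  moreover have "p ` ?T = S"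
    using p(2) S by (auto simp only: submod_def image_iff)
  ultimately show ?thesis by simp
qed

text \<open>
  The Hopkins--Akizuki theorem for commutative rings, by a minimal counterexample in place of
  composition series.  If some ideal is not finitely generated, the descending chain condition
  gives a minimal such ideal \<open>I\<close>.  For each \<open>r\<close>, multiplication by
  \<open>r\<close> on \<open>I\<close> has kernel and image inside \<open>I\<close>; if both
  were proper, both would be finitely generated and so would \<open>I\<close>.  Hence \<open>r I = I\<close> or
  \<open>r I = 0\<close>, and in the first case \<open>r\<close> acts invertibly, because the chain of
  the ideals generated by the powers of \<open>r\<close> becomes stationary.  So \<open>I\<close> behaves like a
  vector space, in which every subspace has a complement.  A complement \<open>J\<close> of a line is a proper
  part of \<open>I\<close>, hence finitely generated, and therefore so is \<open>I\<close>.
\<close>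

lemma artinian_cring_imp_noetherian:
  assumes art: "artinian_cring R"
  shows "left_noetherian R"
proof (rule ccontr)
  interpret R: cring R using art by (simp add: artinian_cring_def)
  let ?M = "regular_module R"
  note M = left_module_regular[OF R.ring_axioms]
  have ideal: "ideal I R" if "submod R ?M I" for I
  proof (rule idealI[OF R.ring_axioms])
    have I: "I \<subseteq> carrier R" using that by (simp add: submod_def)
    have neg: "\<ominus>\<^bsub>R\<^esub> x \<in> I" if x: "x \<in> I" for x
    proof -
      have "(\<ominus>\<^bsub>R\<^esub> \<one>\<^bsub>R\<^esub>) \<otimes>\<^bsub>R\<^esub> x \<in> I"
      using \<open>submod R ?M I\<close> x by (simp add: submod_def)
      then show ?thesis using I x by (simp add: R.l_minus subset_iff)
    qed
    show "subgroup I (add_monoid R)"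
      using that I neg by (intro subgroup.intro) (auto simp: submod_def a_inv_def)
    fix a x assume a: "a \<in> I" and x: "x \<in> carrier R"
    show "x \<otimes>\<^bsub>R\<^esub> a \<in> I" using that a x by (simp add: submod_def)
    then show "a \<otimes>\<^bsub>R\<^esub> x \<in> I" using R.m_comm[of a x] a x I by (simp add: subset_iff)
  qed
  have dcc: "\<forall>I :: nat \<Rightarrow> _. (\<forall>n. ideal (I n) R \<and> I (Suc n) \<subseteq> I n) \<longrightarrow> (\<exists>N. \<forall>n\<ge>N. I n = I N)"
    using art by (simp add: artinian_cring_def)
  (* wf_iff_no_infinite_down_chain turns the chain condition into the existence of minimal elements. *)
  define less where "less = {(I, J). submod R ?M I \<and> submod R ?M J \<and> I \<subset> J}"
  have "wf less"
    unfolding wf_iff_no_infinite_down_chain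
  proof
    assume "\<exists>f. \<forall>i. (f (Suc i), f i) \<in> less"
    then obtain f where f: "\<And>i. submod R ?M (f i)" "\<And>i. f (Suc i) \<subset> f i"
      unfolding less_def by blast
    then have "\<forall>n. ideal (f n) R \<and> f (Suc n) \<subseteq> f n" using ideal by blast
    then obtain N where "\<forall>n\<ge>N. f n = f N" using dcc by blast
    then have "f (Suc N) = f N" using le_SucI by blast
    with f(2)[of N] show False by simp
  qed
  assume "\<not> left_noetherian R"
  then have "\<exists>I. I \<in> {I. submod R ?M I \<and> \<not> fin_gen R ?M I}" by (auto simp: left_noetherian_def)
  then obtain I where I: "submod R ?M I" "\<not> fin_gen R ?M I"
    and min: "\<And>J. (J, I) \<in> less \<Longrightarrow> \<not> (submod R ?M J \<and> \<not> fin_gen R ?M J)"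
    using wfE_min[OF \<open>wf less\<close>] by (metis (mono_tags, lifting) mem_Collect_eq)
  have proper: "fin_gen R ?M J" if "submod R ?M J" "J \<subseteq> I" "J \<noteq> I" for J
    using min[of J] that I(1) by (auto simp: less_def)
  have IR: "x \<in> carrier R" if "x \<in> I" for x using I(1) that by (auto simp: submod_def)
  have mult: "lin R ?M ?M (\<lambda>x. r \<otimes>\<^bsub>R\<^esub> x)" if "r \<in> carrier R" for r
    using that by (intro linI) (auto simp: R.r_distr R.m_lcomm)
  have dich: "(\<lambda>x. r \<otimes>\<^bsub>R\<^esub> x) ` I = I \<or> (\<forall>x\<in>I. r \<otimes>\<^bsub>R\<^esub> x = \<zero>\<^bsub>R\<^esub>)" if r: "r \<in> carrier R" for r
  proof (rule ccontr)
    assume neg: "\<not> ?thesis"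
    have "submod R ?M ((\<lambda>x. r \<otimes>\<^bsub>R\<^esub> x) ` I)"
      by (rule submod_image[OF M M mult[OF r] I(1)])
    moreover have "(\<lambda>x. r \<otimes>\<^bsub>R\<^esub> x) ` I \<subseteq> I" using I(1) r by (auto simp: submod_def)
    ultimately have im: "fin_gen R ?M ((\<lambda>x. r \<otimes>\<^bsub>R\<^esub> x) ` I)" using proper neg by blast
    have "submod R ?M {x \<in> I. r \<otimes>\<^bsub>R\<^esub> x = \<zero>\<^bsub>?M\<^esub>}"
      using submod_vimage[OF M M mult[OF r] I(1) submod_zero[OF M]] by simp
    moreover have "{x \<in> I. r \<otimes>\<^bsub>R\<^esub> x = \<zero>\<^bsub>?M\<^esub>} \<noteq> I" using neg by auto
    ultimately have "fin_gen R ?M {x \<in> I. r \<otimes>\<^bsub>R\<^esub> x = \<zero>\<^bsub>?M\<^esub>}" using proper by blast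
    then show False using fin_gen_extension[OF M M I(1) mult[OF r] im] I(2) by blast
  qed
  have inv: "\<exists>t\<in>carrier R. \<forall>x\<in>I. t \<otimes>\<^bsub>R\<^esub> (r \<otimes>\<^bsub>R\<^esub> x) = x"
    if r: "r \<in> carrier R" and ne: "\<not> (\<forall>x\<in>I. r \<otimes>\<^bsub>R\<^esub> x = \<zero>\<^bsub>R\<^esub>)" for r
  proof -
    have rI: "(\<lambda>x. r \<otimes>\<^bsub>R\<^esub> x) ` I = I" using dich[OF r] ne by blast
    have pow: "(\<lambda>x. (r [^]\<^bsub>R\<^esub> n) \<otimes>\<^bsub>R\<^esub> x) ` I = I" for n :: nat
    proof (induction n)
      case 0
      show ?case using IR by (auto simp: image_iff)
    next
      case (Suc n)
      have "(\<lambda>x. (r [^]\<^bsub>R\<^esub> Suc n) \<otimes>\<^bsub>R\<^esub> x) ` I = (\<lambda>x. (r [^]\<^bsub>R\<^esub> n) \<otimes>\<^bsub>R\<^esub> x) ` (\<lambda>x. r \<otimes>\<^bsub>R\<^esub> x) ` I"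
        unfolding image_image using r IR by (intro image_cong) (auto simp: R.m_assoc)
      also have "\<dots> = I" unfolding rI by (rule Suc)
      finally show ?case .
    qed
    define J where "J n = (\<lambda>x. (r [^]\<^bsub>R\<^esub> n) \<otimes>\<^bsub>R\<^esub> x) ` carrier R" for n :: nat
    have J: "submod R ?M (J n)" for n
      using submod_image[OF M M mult submod_carrier[OF M]] r by (simp add: J_def)
    have "J (Suc n) \<subseteq> J n" for n
    proof
      fix u assume "u \<in> J (Suc n)"
      then obtain v where v: "v \<in> carrier R" "u = (r [^]\<^bsub>R\<^esub> Suc n) \<otimes>\<^bsub>R\<^esub> v" by (auto simp: J_def)
      then have "u = (r [^]\<^bsub>R\<^esub> n) \<otimes>\<^bsub>R\<^esub> (r \<otimes>\<^bsub>R\<^esub> v)" using r by (simp add: R.m_assoc)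
      then show "u \<in> J n" using r v(1) by (auto simp: J_def)
    qed
    then have "\<forall>n. ideal (J n) R \<and> J (Suc n) \<subseteq> J n" using ideal J by blast
    then obtain n where n: "\<forall>m\<ge>n. J m = J n" using dcc by blast
    have "r [^]\<^bsub>R\<^esub> n \<in> J n"
      unfolding J_def using r by (intro image_eqI[of _ _ "\<one>\<^bsub>R\<^esub>"]) simp_all
    then have "r [^]\<^bsub>R\<^esub> n \<in> J (Suc n)" using n le_SucI by blast
    then obtain t where t: "t \<in> carrier R" "r [^]\<^bsub>R\<^esub> n = (r [^]\<^bsub>R\<^esub> Suc n) \<otimes>\<^bsub>R\<^esub> t"
      by (auto simp: J_def)
    (* Write x = r^n y; then t r x = t r^(n+1) y = r^n y = x, as t r^(n+1) = r^n. *)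
    have "t \<otimes>\<^bsub>R\<^esub> (r \<otimes>\<^bsub>R\<^esub> x) = x" if x: "x \<in> I" for x
    proof -
      obtain y where y: "y \<in> I" "x = (r [^]\<^bsub>R\<^esub> n) \<otimes>\<^bsub>R\<^esub> y" using pow[of n] x by blast
      have "t \<otimes>\<^bsub>R\<^esub> (r \<otimes>\<^bsub>R\<^esub> x) = ((r [^]\<^bsub>R\<^esub> Suc n) \<otimes>\<^bsub>R\<^esub> t) \<otimes>\<^bsub>R\<^esub> y"
        using t(1) r IR[OF y(1)] y(2) by (simp add: R.m_ac)
      then show ?thesis unfolding t(2)[symmetric] y(2)[symmetric] .
    qed
    then show ?thesis using t(1) by blast
  qed
  have "I \<noteq> {\<zero>\<^bsub>?M\<^esub>}" using I(2) fin_gen_zero[of R ?M] by metis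
  then obtain x where x: "x \<in> I" "x \<noteq> \<zero>\<^bsub>R\<^esub>" using I(1) by (auto simp: submod_def)
  (* A complement of the line spanned by x is a submodule maximal among those that avoid x. *)
  let ?C = "{J. submod R ?M J \<and> J \<subseteq> I \<and> x \<notin> J}"
  have "\<exists>J\<in>?C. \<forall>X\<in>?C. J \<subseteq> X \<longrightarrow> X = J"
  proof (rule subset_Zorn_nonempty)
    show "?C \<noteq> {}"
      using submod_zero[OF M] x I(1) by (auto simp: submod_def intro!: exI[of _ "{\<zero>\<^bsub>R\<^esub>}"])
    fix C assume C: "C \<noteq> {}" "subset.chain ?C C"
    have mem: "submod R ?M J" "J \<subseteq> I" "x \<notin> J" if "J \<in> C" for J
      using C(2) that by (auto simp: subset.chain_def)
    have "submod R ?M (\<Union>C)"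
      unfolding submod_def
    proof (intro conjI ballI)
      show "\<Union>C \<subseteq> carrier ?M" using mem(1) by (force simp: submod_def)
      show "\<zero>\<^bsub>?M\<^esub> \<in> \<Union>C" using mem(1) C(1) unfolding submod_def by blast
      fix u assume "u \<in> \<Union>C"
      then obtain J where J: "J \<in> C" "u \<in> J" by blast
      { fix v assume "v \<in> \<Union>C"
        then obtain K where K: "K \<in> C" "v \<in> K" by blast
        have "J \<subseteq> K \<or> K \<subseteq> J" using C(2) J K by (auto simp: subset_chain_def)
        then obtain L where "L \<in> C" "u \<in> L" "v \<in> L" using J K by blast
        then show "u \<oplus>\<^bsub>?M\<^esub> v \<in> \<Union>C" using mem(1)[of L] unfolding submod_def by blast }
      { fix a assume "a \<in> carrier R"
        then show "a \<odot>\<^bsub>?M\<^esub> u \<in> \<Union>C" using mem(1)[of J] J unfolding submod_def by blast }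
    qed
    then show "\<Union>C \<in> ?C" using mem by blast
  qed
  then obtain J where JC: "J \<in> ?C" and maxC: "\<forall>X\<in>?C. J \<subseteq> X \<longrightarrow> X = J" by (elim bexE)
  have J: "submod R ?M J" "J \<subseteq> I" "x \<notin> J" using JC by auto
  have max: "X = J" if "submod R ?M X" "X \<subseteq> I" "x \<notin> X" "J \<subseteq> X" for X
    using bspec[OF maxC, of X] that by simp
  have JR: "u \<in> carrier R" if "u \<in> J" for u using J(2) IR that by blast
  have "fin_gen R ?M J" using proper J x(1) by blast
  then obtain gs where gs: "set gs \<subseteq> J"
    "\<And>u. u \<in> J \<Longrightarrow> \<exists>cs. set cs \<subseteq> carrier R \<and> length cs = length gs \<and> u = lincomb ?M cs gs"
    by (auto simp: fin_gen_def)
  have span: "\<exists>r\<in>carrier R. \<exists>j\<in>J. y = r \<otimes>\<^bsub>R\<^esub> x \<oplus>\<^bsub>R\<^esub> j" if y: "y \<in> I" for y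
  proof (cases "y \<in> J")
    case True
    then show ?thesis using IR x y by (intro bexI[of _ "\<zero>\<^bsub>R\<^esub>"] bexI[of _ y]) auto
  next
    case False
    (* K is the submodule generated by y and J; by maximality of J it contains x, and the relation
       expressing this can be solved for y because r acts invertibly. *)
    define K where "K = {r \<otimes>\<^bsub>R\<^esub> y \<oplus>\<^bsub>R\<^esub> j |r j. r \<in> carrier R \<and> j \<in> J}"
    have KI: "\<And>r j. r \<in> carrier R \<Longrightarrow> j \<in> J \<Longrightarrow> r \<otimes>\<^bsub>R\<^esub> y \<oplus>\<^bsub>R\<^esub> j \<in> K" by (auto simp: K_def)
    have zJ: "\<zero>\<^bsub>R\<^esub> \<in> J" using J(1) by (simp add: submod_def)
    have yR: "y \<in> carrier R" using y IR by blast
    have JK: "J \<subseteq> K" using KI[of "\<zero>\<^bsub>R\<^esub>"] JR yR by auto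
    have yK: "y \<in> K" using KI[of "\<one>\<^bsub>R\<^esub>" "\<zero>\<^bsub>R\<^esub>"] zJ yR by simp
    have "submod R ?M K"
      unfolding submod_def
    proof (intro conjI ballI)
      show "K \<subseteq> carrier ?M" using JR yR by (auto simp: K_def)
      show "\<zero>\<^bsub>?M\<^esub> \<in> K" using JK zJ by auto
      fix u assume "u \<in> K"
      then obtain r j where u: "u = r \<otimes>\<^bsub>R\<^esub> y \<oplus>\<^bsub>R\<^esub> j" "r \<in> carrier R" "j \<in> J" by (auto simp: K_def)
      { fix v assume "v \<in> K"
        then obtain s k where v: "v = s \<otimes>\<^bsub>R\<^esub> y \<oplus>\<^bsub>R\<^esub> k" "s \<in> carrier R" "k \<in> J" by (auto simp: K_def)
        have "u \<oplus>\<^bsub>R\<^esub> v = (r \<oplus>\<^bsub>R\<^esub> s) \<otimes>\<^bsub>R\<^esub> y \<oplus>\<^bsub>R\<^esub> (j \<oplus>\<^bsub>R\<^esub> k)"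
          using u v JR yR by (simp add: R.l_distr R.a_ac)
        then show "u \<oplus>\<^bsub>?M\<^esub> v \<in> K" using KI[of "r \<oplus>\<^bsub>R\<^esub> s" "j \<oplus>\<^bsub>R\<^esub> k"] u v J(1) by (simp add: submod_def) }
      { fix a assume a: "a \<in> carrier R"
        have "a \<otimes>\<^bsub>R\<^esub> u = (a \<otimes>\<^bsub>R\<^esub> r) \<otimes>\<^bsub>R\<^esub> y \<oplus>\<^bsub>R\<^esub> (a \<otimes>\<^bsub>R\<^esub> j)"
          using u a JR yR by (simp add: R.r_distr R.m_assoc)
        then show "a \<odot>\<^bsub>?M\<^esub> u \<in> K"
          using KI[of "a \<otimes>\<^bsub>R\<^esub> r" "a \<otimes>\<^bsub>R\<^esub> j"] u a J(1) by (simp add: submod_def) }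
    qed
    moreover have "K \<subseteq> I" using I(1) J(2) y by (auto simp: K_def submod_def)
    ultimately have "x \<in> K" using max[of K] JK yK False by blast
    then obtain r j where rj: "x = r \<otimes>\<^bsub>R\<^esub> y \<oplus>\<^bsub>R\<^esub> j" "r \<in> carrier R" "j \<in> J" by (auto simp: K_def)
    have "r \<otimes>\<^bsub>R\<^esub> y \<noteq> \<zero>\<^bsub>R\<^esub>" using rj J(3) JR by auto
    then obtain t where t: "t \<in> carrier R" "t \<otimes>\<^bsub>R\<^esub> (r \<otimes>\<^bsub>R\<^esub> y) = y" using inv[OF rj(2)] y by blast
    have "t \<otimes>\<^bsub>R\<^esub> x = y \<oplus>\<^bsub>R\<^esub> t \<otimes>\<^bsub>R\<^esub> j"
      using t rj JR yR by (simp add: R.r_distr)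
    then have "y = t \<otimes>\<^bsub>R\<^esub> x \<oplus>\<^bsub>R\<^esub> (\<ominus>\<^bsub>R\<^esub> t) \<otimes>\<^bsub>R\<^esub> j"
      using t rj(3) JR yR by (simp add: R.l_minus R.a_assoc R.r_neg)
    moreover have "(\<ominus>\<^bsub>R\<^esub> t) \<otimes>\<^bsub>R\<^esub> j \<in> J" using J(1) t rj(3) by (simp add: submod_def)
    ultimately show ?thesis using t(1) by blast
  qed
  have "fin_gen R ?M I"
    unfolding fin_gen_def
  proof (rule exI[of _ "x # gs"], intro conjI ballI)
    show "set (x # gs) \<subseteq> I" using x gs(1) J(2) by auto
    fix y assume "y \<in> I"
    then obtain r j where rj: "r \<in> carrier R" "j \<in> J" "y = r \<otimes>\<^bsub>R\<^esub> x \<oplus>\<^bsub>R\<^esub> j" using span by blast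
    then obtain cs where "set cs \<subseteq> carrier R" "length cs = length gs" "j = lincomb ?M cs gs"
      using gs(2) by blast
    then show "\<exists>cs. set cs \<subseteq> carrier R \<and> length cs = length (x # gs) \<and> y = lincomb ?M cs (x # gs)"
      using rj by (intro exI[of _ "r # cs"]) simp
  qed
  then show False using I(2) by blast
qed

text \<open>
  A left ideal of the algebra is a submodule of a finitely generated module over the noetherian
  base ring, and generators over the base ring also generate over the algebra.
\<close>

lemma artin_algebra_noetherian:
  assumes "artin_algebra R \<phi> A"
  shows "left_noetherian A"
  unfolding left_noetherian_def
proof (intro allI impI)
  have art: "artinian_cring R" and A: "ring A" and \<phi>: "\<phi> \<in> ring_hom R A"
    and fg: "finitely_generated R (algebra_as_module \<phi> A)"
    using assms by (auto simp: artin_algebra_def)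
  interpret R: cring R using art by (simp add: artinian_cring_def)
  interpret A: ring A by fact
  let ?M = "algebra_as_module \<phi> A"
  have simps: "carrier ?M = carrier A" "\<zero>\<^bsub>?M\<^esub> = \<zero>\<^bsub>A\<^esub>" "\<And>x y. x \<oplus>\<^bsub>?M\<^esub> y = x \<oplus>\<^bsub>A\<^esub> y"
    "\<And>r x. r \<odot>\<^bsub>?M\<^esub> x = \<phi> r \<otimes>\<^bsub>A\<^esub> x"
    by (simp_all add: algebra_as_module_def)
  have "abelian_group ?M"
    by (rule abelian_groupI) (auto simp: simps A.a_ac intro: A.l_neg)
  then have M: "left_module R ?M"
    using \<phi> by (intro left_module.intro left_module_axioms.intro R.ring_axioms)
      (auto simp: simps ring_hom_def A.l_distr A.r_distr A.m_assoc Pi_iff)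
  fix I assume I: "submod A (regular_module A) I"
  then have "submod R ?M I" using \<phi> by (auto simp: submod_def simps ring_hom_def)
  moreover have "fin_gen R ?M (carrier ?M)" using fg finitely_generated_iff_fin_gen[OF M] by simp
  ultimately have "fin_gen R ?M I"
    using noetherian_submodule[OF R.ring_axioms artinian_cring_imp_noetherian[OF art] M] by blast
  moreover have "lincomb ?M cs gs = lincomb (regular_module A) (map \<phi> cs) gs" for cs gs
  proof (induction cs arbitrary: gs)
    case (Cons c cs)
    then show ?case by (cases gs) (auto simp: simps)
  qed (simp add: simps)
  moreover have "set (map \<phi> cs) \<subseteq> carrier A" if "set cs \<subseteq> carrier R" for cs
    using that \<phi> by (auto simp: ring_hom_def)
  ultimately show "fin_gen A (regular_module A) I"
    unfolding fin_gen_def by (metis length_map)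
qed

section \<open>Exactness of Hom complexes\<close>

text \<open>
  Exactness at the middle term of Hom applied to \<open>X \<rightarrow> Y \<rightarrow> Z\<close>, in
  elementary form: a map that vanishes on the image of \<open>d\<close> extends along
  \<open>e\<close>.  Both the vanishing of Ext and the second condition on a complete projective
  resolution amount to it.
\<close>

definition Hom_exact ::
    "('a, 'x) ring_scheme \<Rightarrow> ('a, 'n) module \<Rightarrow> ('a, 'm) module \<Rightarrow> ('m \<Rightarrow> 'm) \<Rightarrow>
     ('a, 'm) module \<Rightarrow> ('m \<Rightarrow> 'm) \<Rightarrow> ('a, 'm) module \<Rightarrow> bool" where
  "Hom_exact A N X d Y e Z \<longleftrightarrow>
    (\<forall>f. lin A Y N f \<longrightarrow> (\<forall>x\<in>carrier X. f (d x) = \<zero>\<^bsub>N\<^esub>) \<longrightarrow>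
      (\<exists>g. lin A Z N g \<and> (\<forall>y\<in>carrier Y. f y = g (e y))))"

lemma Hom_group_simps [simp]:
  "carrier (Hom_group A M N) = mod_hom A M N"
  "\<one>\<^bsub>Hom_group A M N\<^esub> = (\<lambda>x\<in>carrier M. \<zero>\<^bsub>N\<^esub>)"
  "f \<otimes>\<^bsub>Hom_group A M N\<^esub> g = (\<lambda>x\<in>carrier M. f x \<oplus>\<^bsub>N\<^esub> g x)"
  by (simp_all add: Hom_group_def)

lemma Hom_group_comm_group:
  assumes M: "left_module A M" and N: "left_module A N"
  shows "comm_group (Hom_group A M N)"
proof -
  interpret M: left_module A M by fact
  interpret N: left_module A N by fact
  have cl: "f x \<in> carrier N" if "f \<in> mod_hom A M N" "x \<in> carrier M" for f x
    using that by (auto simp: mod_hom_def)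
  have ext: "(\<lambda>x\<in>carrier M. f x) = f" if "f \<in> mod_hom A M N" for f
    using that by (simp add: mod_hom_iff extensional_restrict)
  show ?thesis
  proof (rule comm_groupI)
    fix f g assume "f \<in> carrier (Hom_group A M N)" "g \<in> carrier (Hom_group A M N)"
    then show "f \<otimes>\<^bsub>Hom_group A M N\<^esub> g \<in> carrier (Hom_group A M N)"
      using restrict_mod_hom[OF M lin_plus[OF N]] mod_hom_lin by fastforce
  next
    show "\<one>\<^bsub>Hom_group A M N\<^esub> \<in> carrier (Hom_group A M N)"
      using restrict_mod_hom[OF M lin_const_zero[OF N]] by simp
  next
    fix f g h assume "f \<in> carrier (Hom_group A M N)" "g \<in> carrier (Hom_group A M N)"
      "h \<in> carrier (Hom_group A M N)"
    then show "f \<otimes>\<^bsub>Hom_group A M N\<^esub> g \<otimes>\<^bsub>Hom_group A M N\<^esub> h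
        = f \<otimes>\<^bsub>Hom_group A M N\<^esub> (g \<otimes>\<^bsub>Hom_group A M N\<^esub> h)"
      by (auto simp: cl N.M.a_assoc intro!: restrict_ext)
  next
    fix f g assume "f \<in> carrier (Hom_group A M N)" "g \<in> carrier (Hom_group A M N)"
    then show "f \<otimes>\<^bsub>Hom_group A M N\<^esub> g = g \<otimes>\<^bsub>Hom_group A M N\<^esub> f"
      by (auto simp: cl N.M.a_comm intro!: restrict_ext)
  next
    fix f assume f: "f \<in> carrier (Hom_group A M N)"
    have "(\<lambda>x\<in>carrier M. \<one>\<^bsub>Hom_group A M N\<^esub> x \<oplus>\<^bsub>N\<^esub> f x) = (\<lambda>x\<in>carrier M. f x)"
      using f by (intro restrict_ext) (simp add: cl)
    then show "\<one>\<^bsub>Hom_group A M N\<^esub> \<otimes>\<^bsub>Hom_group A M N\<^esub> f = f"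
      using ext[of f] f by simp
    let ?g = "\<lambda>x\<in>carrier M. \<ominus>\<^bsub>N\<^esub> f x"
    have "?g \<in> mod_hom A M N"
      using f by (intro restrict_mod_hom[OF M] lin_uminus[OF N] mod_hom_lin) simp
    moreover have "?g \<otimes>\<^bsub>Hom_group A M N\<^esub> f = \<one>\<^bsub>Hom_group A M N\<^esub>"
      using f by (auto simp: cl N.M.l_neg intro!: restrict_ext)
    ultimately show "\<exists>g\<in>carrier (Hom_group A M N). g \<otimes>\<^bsub>Hom_group A M N\<^esub> f = \<one>\<^bsub>Hom_group A M N\<^esub>"
      by (intro bexI[of _ ?g]) simp_all
  qed
qed

lemma compose_mod_hom:
  assumes "left_module A X" and "lin A X Y d" and "f \<in> mod_hom A Y N"
  shows "compose (carrier X) f d \<in> mod_hom A X N"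
  unfolding compose_def
  using restrict_mod_hom[OF assms(1) lin_comp[OF assms(2) mod_hom_lin[OF assms(3)]]] .

lemma kernel_Hom_subgroup:
  assumes X: "left_module A X" and Y: "left_module A Y" and N: "left_module A N" and d: "lin A X Y d"
  shows "subgroup (kernel (Hom_group A Y N) (Hom_group A X N) (\<lambda>f. compose (carrier X) f d))
    (Hom_group A Y N)"
proof (rule group_hom.subgroup_kernel)
  have "(\<lambda>f. compose (carrier X) f d) \<in> hom (Hom_group A Y N) (Hom_group A X N)"
    unfolding hom_def
    using lin_closed[OF d] compose_mod_hom[OF X d, of _ N]
    by (auto simp: compose_def intro!: restrict_ext)
  then show "group_hom (Hom_group A Y N) (Hom_group A X N) (\<lambda>f. compose (carrier X) f d)"
    using Hom_group_comm_group[OF X N] Hom_group_comm_group[OF Y N]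
    by (auto simp: group_hom_def group_hom_axioms_def comm_group_def)
qed

lemma kernel_Hom_eq:
  assumes d: "lin A X Y d"
  shows "kernel (Hom_group A Y N) (Hom_group A X N) (\<lambda>f. compose (carrier X) f d) =
    {f \<in> mod_hom A Y N. \<forall>x\<in>carrier X. f (d x) = \<zero>\<^bsub>N\<^esub>}"
  using lin_closed[OF d] by (auto simp: kernel_def compose_def fun_eq_iff)

lemma Hom_exact_iff_image_eq_kernel:
  assumes X: "left_module A X" and Y: "left_module A Y" and Z: "left_module A Z"
    and N: "left_module A N" and d: "lin A X Y d" and e: "lin A Y Z e"
    and ed: "\<And>x. x \<in> carrier X \<Longrightarrow> e (d x) = \<zero>\<^bsub>Z\<^esub>"
  shows "(\<lambda>f. compose (carrier Y) f e) ` mod_hom A Z N =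
      kernel (Hom_group A Y N) (Hom_group A X N) (\<lambda>f. compose (carrier X) f d)
    \<longleftrightarrow> Hom_exact A N X d Y e Z"
proof -
  have sub: "(\<lambda>f. compose (carrier Y) f e) ` mod_hom A Z N \<subseteq>
      {f \<in> mod_hom A Y N. \<forall>x\<in>carrier X. f (d x) = \<zero>\<^bsub>N\<^esub>}"
    using compose_mod_hom[OF Y e, of _ N] lin_closed[OF d] lin_zero[OF Z N mod_hom_lin] ed
    by (auto simp: compose_def)
  have "{f \<in> mod_hom A Y N. \<forall>x\<in>carrier X. f (d x) = \<zero>\<^bsub>N\<^esub>}
      \<subseteq> (\<lambda>f. compose (carrier Y) f e) ` mod_hom A Z N" if ex: "Hom_exact A N X d Y e Z"
  proof
    fix f assume f: "f \<in> {f \<in> mod_hom A Y N. \<forall>x\<in>carrier X. f (d x) = \<zero>\<^bsub>N\<^esub>}"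
    then obtain g where g: "lin A Z N g" "\<forall>y\<in>carrier Y. f y = g (e y)"
      using ex mod_hom_lin unfolding Hom_exact_def by blast
    have "f = compose (carrier Y) (restrict g (carrier Z)) e"
      using f g(2) lin_closed[OF e] by (auto simp: compose_def mod_hom_iff extensional_def fun_eq_iff)
    then show "f \<in> (\<lambda>f. compose (carrier Y) f e) ` mod_hom A Z N"
      using restrict_mod_hom[OF Z g(1)] by blast
  qed
  moreover have "Hom_exact A N X d Y e Z"
    if im: "{f \<in> mod_hom A Y N. \<forall>x\<in>carrier X. f (d x) = \<zero>\<^bsub>N\<^esub>}
      \<subseteq> (\<lambda>f. compose (carrier Y) f e) ` mod_hom A Z N"
    unfolding Hom_exact_def
  proof (intro allI impI)
    fix f assume f: "lin A Y N f" "\<forall>x\<in>carrier X. f (d x) = \<zero>\<^bsub>N\<^esub>"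
    have "restrict f (carrier Y) \<in> {f \<in> mod_hom A Y N. \<forall>x\<in>carrier X. f (d x) = \<zero>\<^bsub>N\<^esub>}"
      using restrict_mod_hom[OF Y f(1)] f(2) lin_closed[OF d] by auto
    then obtain g where g: "g \<in> mod_hom A Z N" "restrict f (carrier Y) = compose (carrier Y) g e"
      using im by blast
    have "f y = g (e y)" if "y \<in> carrier Y" for y
      using fun_cong[OF g(2), of y] that by (simp add: compose_def)
    then show "\<exists>g. lin A Z N g \<and> (\<forall>y\<in>carrier Y. f y = g (e y))"
      using mod_hom_lin[OF g(1)] by blast
  qed
  ultimately show ?thesis
    unfolding kernel_Hom_eq[OF d] using sub by blast
qed

text \<open>
  The quotient of cocycles by coboundaries is trivial exactly if the two groups coincide.
\<close>

lemma trivial_Ext_of_resolution_iff: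
  assumes P: "\<And>n. left_module A (P n)" and N: "left_module A N"
    and d: "\<And>n. lin A (P (Suc n)) (P n) (d n)"
    and dd: "\<And>n x. x \<in> carrier (P (Suc (Suc n))) \<Longrightarrow> d n (d (Suc n) x) = \<zero>\<^bsub>P n\<^esub>"
  shows "trivial_group (Ext_of_resolution A (Suc n) P d N) \<longleftrightarrow>
    Hom_exact A N (P (Suc (Suc n))) (d (Suc n)) (P (Suc n)) (d n) (P n)"
proof -
  let ?G = "Hom_group A (P (Suc n)) N"
  define Z where "Z = cocycles A P d N (Suc n)"
  define B where "B = coboundaries A P d N (Suc n)"
  let ?Z = "?G\<lparr>carrier := Z\<rparr>"
  interpret G: comm_group ?G by (rule Hom_group_comm_group[OF P N])
  have subZ: "subgroup Z ?G"
    unfolding Z_def cocycles_def by (rule kernel_Hom_subgroup[OF P P N d])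
  interpret Z: group ?Z by (rule subgroup.subgroup_is_group[OF subZ G.is_group])
  have iff: "B = Z \<longleftrightarrow> Hom_exact A N (P (Suc (Suc n))) (d (Suc n)) (P (Suc n)) (d n) (P n)"
    unfolding B_def Z_def cocycles_def coboundaries.simps
    by (rule Hom_exact_iff_image_eq_kernel[OF P P P N d d dd])
  have "trivial_group (?Z Mod B)" if "B = Z"
  proof -
    have "Z \<lhd> ?Z" using Z.normal_self by simp
    then interpret Q: group "?Z Mod Z" by (rule normal.factorgroup_is_group)
    have "carrier (?Z Mod Z) \<subseteq> {Z}"
      using Z.coset_join2[OF _ Z.subgroup_self] by (auto simp: FactGroup_def RCOSETS_def)
    then show ?thesis using that Q.trivial_group_alt by blast
  qed
  moreover have "B = Z" if triv: "trivial_group (?Z Mod B)"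
  proof
    let ?o = "\<lambda>x\<in>carrier (P (Suc n)). \<zero>\<^bsub>N\<^esub>"
    have "\<one>\<^bsub>Hom_group A (P n) N\<^esub> \<in> mod_hom A (P n) N"
      using restrict_mod_hom[OF P lin_const_zero[OF N]] by simp
    moreover have "?o = compose (carrier (P (Suc n))) \<one>\<^bsub>Hom_group A (P n) N\<^esub> (d n)"
      using lin_closed[OF d] by (auto simp: compose_def fun_eq_iff)
    ultimately have oB: "\<one>\<^bsub>?Z\<^esub> \<in> B" unfolding B_def by auto
    show "Z \<subseteq> B"
    proof
      fix f assume f: "f \<in> Z"
      have "B #>\<^bsub>?Z\<^esub> f \<in> carrier (?Z Mod B)" using f by (auto simp: FactGroup_def RCOSETS_def)
      then have "B #>\<^bsub>?Z\<^esub> f = B" using triv by (auto simp: trivial_group_def FactGroup_def)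
      moreover have "f \<in> B #>\<^bsub>?Z\<^esub> f"
        using oB Z.l_one[of f] f unfolding r_coset_def by (intro UN_I[OF oB]) simp
      ultimately show "f \<in> B" by simp
    qed
    have "(\<lambda>f. compose (carrier (P (Suc n))) f (d n)) ` mod_hom A (P n) N \<subseteq> Z"
      unfolding Z_def cocycles_def kernel_Hom_eq[OF d]
      using compose_mod_hom[OF P d, of _ n N] lin_closed[OF d] lin_zero[OF P N mod_hom_lin] dd
      by (auto simp: compose_def)
    then show "B \<subseteq> Z" by (simp add: B_def)
  qed
  ultimately show ?thesis
    unfolding iff[symmetric] Ext_of_resolution_def Z_def[symmetric] B_def[symmetric] by blast
qed


section \<open>Independence of the resolution\<close>

text \<open>
  A projective resolution with its augmentation as a single sequence: \<open>X 0\<close> is the resolved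
  module and \<open>D 0\<close> the augmentation.  Then the first step of a comparison of
  resolutions has the same shape as all later ones.
\<close>

definition exact_augmented ::
    "('a, 'x) ring_scheme \<Rightarrow> (nat \<Rightarrow> ('a, 'm) module) \<Rightarrow> (nat \<Rightarrow> 'm \<Rightarrow> 'm) \<Rightarrow> bool" where
  "exact_augmented A X D \<longleftrightarrow>
    (\<forall>n. left_module A (X n)) \<and> (\<forall>n. projective_module A (X (Suc n))) \<and>
    (\<forall>n. lin A (X (Suc n)) (X n) (D n)) \<and> D 0 ` carrier (X (Suc 0)) = carrier (X 0) \<and>
    (\<forall>n. D (Suc n) ` carrier (X (Suc (Suc n))) = {x \<in> carrier (X (Suc n)). D n x = \<zero>\<^bsub>X n\<^esub>})"

lemma exact_augmentedD:
  assumes "exact_augmented A X D"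
  shows "left_module A (X n)" and "projective_module A (X (Suc n))"
    and "lin A (X (Suc n)) (X n) (D n)" and "D 0 ` carrier (X (Suc 0)) = carrier (X 0)"
    and "D (Suc n) ` carrier (X (Suc (Suc n))) = {x \<in> carrier (X (Suc n)). D n x = \<zero>\<^bsub>X n\<^esub>}"
  using assms by (simp_all add: exact_augmented_def)

lemma exact_augmented_square_zero:
  assumes "exact_augmented A X D" and "x \<in> carrier (X (Suc (Suc n)))"
  shows "D n (D (Suc n) x) = \<zero>\<^bsub>X n\<^esub>"
  using exact_augmentedD(5)[OF assms(1), of n] assms(2) by blast

lemma exact_augmented_lift:
  fixes P :: "('a, 'm) module" and Y :: "nat \<Rightarrow> ('a, 'm) module"
  assumes Y: "exact_augmented A Y E" and P: "projective_module A P"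
    and h: "lin A P (Y (Suc n)) h" and "\<And>x. x \<in> carrier P \<Longrightarrow> E n (h x) = \<zero>\<^bsub>Y n\<^esub>"
  obtains k where "lin A P (Y (Suc (Suc n))) k"
    and "\<And>x. x \<in> carrier P \<Longrightarrow> E (Suc n) (k x) = h x"
proof -
  note Yd = exact_augmentedD[OF Y]
  have "h ` carrier P \<subseteq> E (Suc n) ` carrier (Y (Suc (Suc n)))"
    unfolding Yd(5) using assms(4) lin_closed[OF h] by auto
  from projective_lift[OF P Yd(1)[of "Suc (Suc n)"] Yd(1)[of "Suc n"] Yd(3)[of "Suc n"] h this]
  show ?thesis using that by blast
qed

text \<open>
  The comparison theorem, one degree at a time.  The maps \<open>a, a'\<close> and \<open>b, b'\<close>
  are two consecutive components of chain maps over the identity, and \<open>s\<close> is a component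
  of a homotopy from \<open>a b\<close> to the identity.  The last conjunct states that the defect of the
  homotopy is a cycle; since \<open>Y\<close> is exact, it is a boundary, and lifting it gives the next component of the homotopy.
  Each stage depends on the previous one only through these properties, so a plain induction on
  the existence of such maps suffices and no infinite chain map has to be chosen.
\<close>

lemma homotopy_equivalence:
  assumes X: "exact_augmented A X D" and Y: "exact_augmented A Y E" and XY: "X 0 = Y 0"
  shows "\<exists>a b a' b' s. lin A (X n) (Y n) a \<and> lin A (Y n) (X n) b \<and>
    lin A (X (Suc n)) (Y (Suc n)) a' \<and> lin A (Y (Suc n)) (X (Suc n)) b' \<and>
    lin A (Y n) (Y (Suc n)) s \<and>
    (\<forall>x\<in>carrier (X (Suc n)). E n (a' x) = a (D n x)) \<and>
    (\<forall>y\<in>carrier (Y (Suc n)). D n (b' y) = b (E n y)) \<and>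
    (\<forall>y\<in>carrier (Y (Suc n)). E n (y \<ominus>\<^bsub>Y (Suc n)\<^esub> a' (b' y) \<ominus>\<^bsub>Y (Suc n)\<^esub> s (E n y)) = \<zero>\<^bsub>Y n\<^esub>)"
proof (induction n)
  note Xd = exact_augmentedD[OF X] and Yd = exact_augmentedD[OF Y]
  {
    case 0
    interpret Y0: left_module A "Y 0" by (rule Yd)
    interpret Y1: left_module A "Y (Suc 0)" by (rule Yd)
    have "D 0 ` carrier (X (Suc 0)) \<subseteq> E 0 ` carrier (Y (Suc 0))" using Xd(4) Yd(4) XY by simp
    moreover have D0: "lin A (X (Suc 0)) (Y 0) (D 0)" using Xd(3)[of 0] XY by simp
    ultimately obtain a' where a': "lin A (X (Suc 0)) (Y (Suc 0)) a'"
      "\<And>x. x \<in> carrier (X (Suc 0)) \<Longrightarrow> E 0 (a' x) = D 0 x"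
      using projective_lift[OF Xd(2) Yd(1) Yd(1) Yd(3)] by blast
    have "E 0 ` carrier (Y (Suc 0)) \<subseteq> D 0 ` carrier (X (Suc 0))" using Xd(4) Yd(4) XY by simp
    moreover have "lin A (Y (Suc 0)) (X 0) (E 0)" using Yd(3)[of 0] XY by simp
    ultimately obtain b' where b': "lin A (Y (Suc 0)) (X (Suc 0)) b'"
      "\<And>y. y \<in> carrier (Y (Suc 0)) \<Longrightarrow> D 0 (b' y) = E 0 y"
      using projective_lift[OF Yd(2) Xd(1) Xd(1) Xd(3)] by blast
    have "E 0 (y \<ominus>\<^bsub>Y (Suc 0)\<^esub> a' (b' y) \<ominus>\<^bsub>Y (Suc 0)\<^esub> \<zero>\<^bsub>Y (Suc 0)\<^esub>) = \<zero>\<^bsub>Y 0\<^esub>"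
      if y: "y \<in> carrier (Y (Suc 0))" for y
    proof -
      note cl = y lin_closed[OF b'(1) y] lin_closed[OF a'(1) lin_closed[OF b'(1) y]]
      show ?thesis
        using cl a'(2)[OF cl(2)] b'(2)[OF y] lin_closed[OF Yd(3) y]
          lin_zero[OF Yd(1) Yd(1) Yd(3), of 0]
        by (simp add: lin_diff[OF Yd(1) Yd(1) Yd(3)] Y0.M.diff_eq_zero_iff)
    qed
    then show ?case
      using a' b' lin_id[of A "X 0"] lin_const_zero[OF Yd(1)] XY
      by (intro exI[of _ "\<lambda>x. x"] exI[of _ a'] exI[of _ b'] exI[of _ "\<lambda>y. \<zero>\<^bsub>Y (Suc 0)\<^esub>"]) auto
  next
    case (Suc n)
    then obtain a b a' b' s where lins: "lin A (X n) (Y n) a" "lin A (Y n) (X n) b"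
      "lin A (X (Suc n)) (Y (Suc n)) a'" "lin A (Y (Suc n)) (X (Suc n)) b'"
      "lin A (Y n) (Y (Suc n)) s"
      and ea: "\<And>x. x \<in> carrier (X (Suc n)) \<Longrightarrow> E n (a' x) = a (D n x)"
      and db: "\<And>y. y \<in> carrier (Y (Suc n)) \<Longrightarrow> D n (b' y) = b (E n y)"
      and hs: "\<And>y. y \<in> carrier (Y (Suc n)) \<Longrightarrow>
        E n (y \<ominus>\<^bsub>Y (Suc n)\<^esub> a' (b' y) \<ominus>\<^bsub>Y (Suc n)\<^esub> s (E n y)) = \<zero>\<^bsub>Y n\<^esub>"
      by blast
    interpret Y1: left_module A "Y (Suc n)" by (rule Yd)
    have "lin A (X (Suc (Suc n))) (Y (Suc n)) (\<lambda>x. a' (D (Suc n) x))"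
      by (rule lin_comp[OF Xd(3) lins(3)])
    moreover have "E n (a' (D (Suc n) x)) = \<zero>\<^bsub>Y n\<^esub>" if x: "x \<in> carrier (X (Suc (Suc n)))" for x
      using ea[OF lin_closed[OF Xd(3) x]] exact_augmented_square_zero[OF X x]
        lin_zero[OF Xd(1) Yd(1) lins(1)] by simp
    ultimately obtain a'' where a'': "lin A (X (Suc (Suc n))) (Y (Suc (Suc n))) a''"
      "\<And>x. x \<in> carrier (X (Suc (Suc n))) \<Longrightarrow> E (Suc n) (a'' x) = a' (D (Suc n) x)"
      using exact_augmented_lift[OF Y Xd(2)] by blast
    have "lin A (Y (Suc (Suc n))) (X (Suc n)) (\<lambda>x. b' (E (Suc n) x))"
      by (rule lin_comp[OF Yd(3) lins(4)])
    moreover have "D n (b' (E (Suc n) x)) = \<zero>\<^bsub>X n\<^esub>" if x: "x \<in> carrier (Y (Suc (Suc n)))" for x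
      using db[OF lin_closed[OF Yd(3) x]] exact_augmented_square_zero[OF Y x]
        lin_zero[OF Yd(1) Xd(1) lins(2)] by simp
    ultimately obtain b'' where b'': "lin A (Y (Suc (Suc n))) (X (Suc (Suc n))) b''"
      "\<And>y. y \<in> carrier (Y (Suc (Suc n))) \<Longrightarrow> D (Suc n) (b'' y) = b' (E (Suc n) y)"
      using exact_augmented_lift[OF X Yd(2)] by blast
    have "lin A (Y (Suc n)) (Y (Suc n)) (\<lambda>y. y \<ominus>\<^bsub>Y (Suc n)\<^esub> a' (b' y) \<ominus>\<^bsub>Y (Suc n)\<^esub> s (E n y))"
      by (intro lin_sub[OF Yd(1)] lin_id lin_comp[OF lins(4,3)] lin_comp[OF Yd(3) lins(5)])
    then obtain s' where s': "lin A (Y (Suc n)) (Y (Suc (Suc n))) s'"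
      "\<And>y. y \<in> carrier (Y (Suc n)) \<Longrightarrow>
        E (Suc n) (s' y) = y \<ominus>\<^bsub>Y (Suc n)\<^esub> a' (b' y) \<ominus>\<^bsub>Y (Suc n)\<^esub> s (E n y)"
      using exact_augmented_lift[OF Y Yd(2)] hs by blast
    have "E (Suc n) (z \<ominus>\<^bsub>Y (Suc (Suc n))\<^esub> a'' (b'' z) \<ominus>\<^bsub>Y (Suc (Suc n))\<^esub> s' (E (Suc n) z))
        = \<zero>\<^bsub>Y (Suc n)\<^esub>" if z: "z \<in> carrier (Y (Suc (Suc n)))" for z
    proof -
      interpret Y2: left_module A "Y (Suc (Suc n))" by (rule Yd)
      note y = lin_closed[OF Yd(3) z]
      note c = lin_closed[OF b''(1) z] and d = lin_closed[OF a''(1) lin_closed[OF b''(1) z]]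
        and e = lin_closed[OF s'(1) y] and f = lin_closed[OF lins(3) lin_closed[OF lins(4) y]]
      have "s (E n (E (Suc n) z)) = \<zero>\<^bsub>Y (Suc n)\<^esub>"
        using exact_augmented_square_zero[OF Y z] lin_zero[OF Yd(1) Yd(1) lins(5)] by simp
      then have "E (Suc n) (s' (E (Suc n) z)) = E (Suc n) z \<ominus>\<^bsub>Y (Suc n)\<^esub> a' (b' (E (Suc n) z))"
        using s'(2)[OF y] y f by (simp add: a_minus_def)
      moreover have "E (Suc n) (a'' (b'' z)) = a' (b' (E (Suc n) z))"
        using a''(2)[OF c] b''(2)[OF z] by simp
      ultimately show ?thesis
        using z d e y f by (simp add: lin_diff[OF Yd(1) Yd(1) Yd(3)] Y1.M.diff_eq_zero_iff)
    qed
    then show ?case using lins(3,4) a'' b'' s'(1) by blast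
  }
qed

text \<open>
  Let \<open>f\<close> be a cocycle on \<open>Y\<close>.  It kills the cycle
  \<open>y - a' b' y - s (E y)\<close>, so \<open>f y = f (a' (b' y)) + f (s (E y))\<close>.  Pulled back to
  \<open>X\<close>, it is a coboundary \<open>g \<circ> D\<close>, whence the first summand equals
  \<open>g (b (E y))\<close>, and \<open>f\<close> factors through \<open>E\<close>.
\<close>

lemma Hom_exact_independent:
  assumes X: "exact_augmented A X D" and Y: "exact_augmented A Y E" and XY: "X 0 = Y 0"
    and N: "left_module A N"
    and ex: "Hom_exact A N (X (Suc (Suc n))) (D (Suc n)) (X (Suc n)) (D n) (X n)"
  shows "Hom_exact A N (Y (Suc (Suc n))) (E (Suc n)) (Y (Suc n)) (E n) (Y n)"
  unfolding Hom_exact_def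
proof (intro allI impI)
  note Xd = exact_augmentedD[OF X] and Yd = exact_augmentedD[OF Y]
  obtain a b a' b' s where lins: "lin A (X n) (Y n) a" "lin A (Y n) (X n) b"
    "lin A (X (Suc n)) (Y (Suc n)) a'" "lin A (Y (Suc n)) (X (Suc n)) b'"
    "lin A (Y n) (Y (Suc n)) s"
    and ea: "\<And>x. x \<in> carrier (X (Suc n)) \<Longrightarrow> E n (a' x) = a (D n x)"
    and db: "\<And>y. y \<in> carrier (Y (Suc n)) \<Longrightarrow> D n (b' y) = b (E n y)"
    and hs: "\<And>y. y \<in> carrier (Y (Suc n)) \<Longrightarrow>
      E n (y \<ominus>\<^bsub>Y (Suc n)\<^esub> a' (b' y) \<ominus>\<^bsub>Y (Suc n)\<^esub> s (E n y)) = \<zero>\<^bsub>Y n\<^esub>"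
    using homotopy_equivalence[OF X Y XY, of n] by blast
  interpret Y1: left_module A "Y (Suc n)" by (rule Yd)
  interpret N: left_module A N by fact
  fix f assume f: "lin A (Y (Suc n)) N f"
    and f0: "\<forall>x\<in>carrier (Y (Suc (Suc n))). f (E (Suc n) x) = \<zero>\<^bsub>N\<^esub>"
  have fker: "f y = \<zero>\<^bsub>N\<^esub>" if "y \<in> carrier (Y (Suc n))" "E n y = \<zero>\<^bsub>Y n\<^esub>" for y
  proof -
    have "y \<in> E (Suc n) ` carrier (Y (Suc (Suc n)))" unfolding Yd(5) using that by simp
    then show ?thesis using f0 by auto
  qed
  have "f (a' (D (Suc n) x)) = \<zero>\<^bsub>N\<^esub>" if x: "x \<in> carrier (X (Suc (Suc n)))" for x
    using ea[OF lin_closed[OF Xd(3) x]] exact_augmented_square_zero[OF X x]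
      lin_zero[OF Xd(1) Yd(1) lins(1)] lin_closed[OF lins(3) lin_closed[OF Xd(3) x]]
    by (intro fker) simp_all
  with lin_comp[OF lins(3) f] ex obtain g where g: "lin A (X n) N g"
    "\<And>x. x \<in> carrier (X (Suc n)) \<Longrightarrow> f (a' x) = g (D n x)"
    unfolding Hom_exact_def by blast
  have "f y = g (b (E n y)) \<oplus>\<^bsub>N\<^esub> f (s (E n y))" if y: "y \<in> carrier (Y (Suc n))" for y
  proof -
    note c = lin_closed[OF lins(4) y]
    note d = lin_closed[OF lins(3) c] and e = lin_closed[OF lins(5) lin_closed[OF Yd(3) y]]
    have "f (y \<ominus>\<^bsub>Y (Suc n)\<^esub> a' (b' y) \<ominus>\<^bsub>Y (Suc n)\<^esub> s (E n y)) = \<zero>\<^bsub>N\<^esub>"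
      using y d e by (intro fker hs) simp_all
    then have "f y \<ominus>\<^bsub>N\<^esub> f (a' (b' y)) = f (s (E n y))"
      using y d e lin_closed[OF f]
      by (simp add: lin_diff[OF Yd(1) N f] N.M.diff_eq_zero_iff)
    then have "f y = f (a' (b' y)) \<oplus>\<^bsub>N\<^esub> f (s (E n y))"
      using y d e lin_closed[OF f]
      by (metis N.M.a_comm N.M.a_inv_closed N.M.a_lcomm N.M.minus_eq N.M.r_neg N.M.r_zero)
    then show ?thesis using g(2)[OF c] db[OF y] by simp
  qed
  moreover have "lin A (Y n) N (\<lambda>y. g (b y) \<oplus>\<^bsub>N\<^esub> f (s y))"
    by (intro lin_plus[OF N] lin_comp[OF lins(2) g(1)] lin_comp[OF lins(5) f])
  ultimately show "\<exists>g. lin A (Y n) N g \<and> (\<forall>y\<in>carrier (Y (Suc n)). f y = g (E n y))"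
    by blast
qed


section \<open>Semi-Gorenstein-projective modules via arbitrary resolutions\<close>

lemma projective_resolutionD:
  assumes "projective_resolution A M P d \<epsilon>"
  shows "P n \<in> fg_modules A" and "projective_module A (P n)" and "lin A (P (Suc n)) (P n) (d n)"
    and "lin A (P 0) M \<epsilon>" and "\<epsilon> ` carrier (P 0) = carrier M"
    and "d 0 ` carrier (P (Suc 0)) = a_kernel (P 0) M \<epsilon>"
    and "d (Suc n) ` carrier (P (Suc (Suc n))) = a_kernel (P (Suc n)) (P n) (d n)"
  using assms by (simp_all add: projective_resolution_def mod_hom_iff)

lemma exact_augmented_resolution:
  assumes M: "left_module A M" and P: "projective_resolution A M P d \<epsilon>"
  shows "exact_augmented A (case_nat M P) (case_nat \<epsilon> d)"
proof -
  note R = projective_resolutionD[OF P]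
  show ?thesis
    unfolding exact_augmented_def
  proof (intro conjI allI)
    fix n
    show "left_module A (case n of 0 \<Rightarrow> M | Suc k \<Rightarrow> P k)"
      using M projective_left_module[OF R(2)] by (cases n) auto
  next
    fix n
    show "lin A (case Suc n of 0 \<Rightarrow> M | Suc k \<Rightarrow> P k) (case n of 0 \<Rightarrow> M | Suc k \<Rightarrow> P k)
        (case n of 0 \<Rightarrow> \<epsilon> | Suc k \<Rightarrow> d k)"
      using R(3,4) by (cases n) auto
  next
    fix n
    show "(case Suc n of 0 \<Rightarrow> \<epsilon> | Suc k \<Rightarrow> d k) ` carrier (case Suc (Suc n) of 0 \<Rightarrow> M | Suc k \<Rightarrow> P k) =
      {x \<in> carrier (case Suc n of 0 \<Rightarrow> M | Suc k \<Rightarrow> P k).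
        (case n of 0 \<Rightarrow> \<epsilon> | Suc k \<Rightarrow> d k) x = \<zero>\<^bsub>case n of 0 \<Rightarrow> M | Suc k \<Rightarrow> P k\<^esub>}"
      using R(6,7) by (cases n) (auto simp: a_kernel_eq)
  qed (use R in auto)
qed

lemma fg_kernel:
  assumes "ring A" and "left_noetherian A" and "P \<in> fg_modules A" and "left_module A M"
    and "lin A P M p"
  shows "P\<lparr>carrier := a_kernel P M p\<rparr> \<in> fg_modules A"
proof -
  have P: "left_module A P" "fin_gen A P (carrier P)"
    using assms(3) by (auto simp: fg_modules_def finitely_generated_iff_fin_gen)
  have K: "submod A P (a_kernel P M p)" by (rule submod_kernel[OF P(1) assms(4,5)])
  then show ?thesis
    using left_module_submod[OF P(1) K] noetherian_submodule[OF assms(1,2) P K]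
    by (simp add: fg_modules_def finitely_generated_iff_fin_gen)
qed

text \<open>
  Iterate the choice of a surjection from a finitely generated projective module; its kernel
  is again finitely generated because the ring is noetherian.  Here \<open>S n\<close> is the \<open>n\<close>-th syzygy, a submodule of the
  projective module chosen for \<open>S (n - 1)\<close>.
\<close>

lemma projective_resolution_exists:
  fixes \<iota> :: "'a list \<Rightarrow> 'm" and M :: "('a, 'm) module"
  assumes A: "ring A" and noeth: "left_noetherian A" and \<iota>: "inj \<iota>" and M: "M \<in> fg_modules A"
  obtains P d \<epsilon> where "projective_resolution A M P d \<epsilon>"
proof -
  have "\<forall>N :: ('a, 'm) module. \<exists>(P :: ('a, 'm) module) p. N \<in> fg_modules A \<longrightarrow> P \<in> fg_modules A \<and>
      projective_module A P \<and> lin A P N p \<and> p ` carrier P = carrier N"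
  proof
    fix N :: "('a, 'm) module"
    show "\<exists>(P :: ('a, 'm) module) p. N \<in> fg_modules A \<longrightarrow> P \<in> fg_modules A \<and>
      projective_module A P \<and> lin A P N p \<and> p ` carrier P = carrier N"
    proof (cases "N \<in> fg_modules A")
      case True
      from fg_projective_surjection[OF A \<iota> True] show ?thesis by metis
    qed blast
  qed
  then obtain C :: "('a, 'm) module \<Rightarrow> ('a, 'm) module" and c where
    C: "\<And>N. N \<in> fg_modules A \<Longrightarrow> C N \<in> fg_modules A" "\<And>N. N \<in> fg_modules A \<Longrightarrow> projective_module A (C N)"
      "\<And>N. N \<in> fg_modules A \<Longrightarrow> lin A (C N) N (c N)"
      "\<And>N. N \<in> fg_modules A \<Longrightarrow> c N ` carrier (C N) = carrier N"
    by metis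
  define K where "K N = (C N)\<lparr>carrier := a_kernel (C N) N (c N)\<rparr>" for N
  define S where "S n = (K ^^ n) M" for n
  have KS: "S (Suc n) = K (S n)" "S 0 = M" for n by (simp_all add: S_def)
  have S: "S n \<in> fg_modules A" for n
  proof (induction n)
    case (Suc n)
    then show ?case
      unfolding KS(1) K_def using C(1,3)[OF Suc]
      by (intro fg_kernel[OF A noeth]) (auto simp: fg_modules_def)
  qed (simp add: KS M)
  have Clm: "left_module A (C (S n))" for n using C(2)[OF S] by (rule projective_left_module)
  have cl: "lin A (C (S (Suc n))) (C (S n)) (c (S (Suc n)))" for n
    using C(3)[OF S[of "Suc n"]] unfolding KS(1) lin_def K_def by (auto simp: a_kernel_eq)
  have im: "c (S (Suc n)) ` carrier (C (S (Suc n))) = a_kernel (C (S n)) (S n) (c (S n))" for n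
    using C(4)[OF S[of "Suc n"]] unfolding KS(1) by (simp add: K_def)
  have ker: "a_kernel (C (S n)) (S n) (restrict f (carrier (C (S n)))) = a_kernel (C (S n)) (S n) f" for n f
    by (auto simp: a_kernel_eq)
  have zero: "\<zero>\<^bsub>S (Suc n)\<^esub> = \<zero>\<^bsub>C (S n)\<^esub>" for n by (simp add: KS K_def)
  define d where "d n = restrict (c (S (Suc n))) (carrier (C (S (Suc n))))" for n
  have "projective_resolution A M (\<lambda>n. C (S n)) d (restrict (c M) (carrier (C M)))"
    unfolding projective_resolution_def
  proof (intro conjI allI)
    fix n
    show "C (S n) \<in> fg_modules A" "projective_module A (C (S n))" using C S by blast+
    show "d n \<in> mod_hom A (C (S (Suc n))) (C (S n))"
      unfolding d_def by (rule restrict_mod_hom[OF Clm cl])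
    have "d (Suc n) ` carrier (C (S (Suc (Suc n)))) =
        a_kernel (C (S (Suc n))) (S (Suc n)) (c (S (Suc n)))"
      using im[of "Suc n"] by (simp add: d_def)
    then show "d (Suc n) ` carrier (C (S (Suc (Suc n)))) = a_kernel (C (S (Suc n))) (C (S n)) (d n)"
      by (auto simp: a_kernel_eq zero d_def)
  next
    show "restrict (c M) (carrier (C M)) \<in> mod_hom A (C (S 0)) M"
      using restrict_mod_hom[OF Clm[of 0]] C(3)[OF M] by (simp add: KS)
    show "restrict (c M) (carrier (C M)) ` carrier (C (S 0)) = carrier M"
      using C(4)[OF M] by (simp add: KS)
    show "d 0 ` carrier (C (S 1)) = a_kernel (C (S 0)) M (restrict (c M) (carrier (C M)))"
      using im[of 0] ker[of 0 "c M"] by (simp add: d_def KS(2))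
  qed
  then show ?thesis by (rule that)
qed

text \<open>
  The definition of Ext picks one resolution by \<^const>\<open>Eps\<close>.  That pick is a resolution as soon as one
  exists, and by the comparison of resolutions any other resolution may be used to test the vanishing.
\<close>

lemma semi_gorenstein_projective_iff:
  fixes \<iota> :: "'a list \<Rightarrow> 'm" and M :: "('a, 'm) module"
  assumes A: "ring A" and noeth: "left_noetherian A" and \<iota>: "inj \<iota>" and M: "M \<in> fg_modules A"
    and P: "projective_resolution A M P d \<epsilon>"
  shows "M \<in> semi_gorenstein_projective A \<longleftrightarrow>
    (\<forall>n. Hom_exact A (regular_module A) (P (Suc (Suc n))) (d (Suc n)) (P (Suc n)) (d n) (P n))"
proof -
  let ?N = "regular_module A"
  have lm: "left_module A M" using M by (simp add: fg_modules_def)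
  note N = left_module_regular[OF A]
  obtain Q e where Qe: "(SOME (P, d). \<exists>\<epsilon>. projective_resolution A M P d \<epsilon>) = (Q, e)"
    by fastforce
  have "\<exists>Pd. (case Pd of (P, d) \<Rightarrow> \<exists>\<epsilon>. projective_resolution A M P d \<epsilon>)" using P by auto
  then have "(case (SOME (P, d). \<exists>\<epsilon>. projective_resolution A M P d \<epsilon>) of
      (P, d) \<Rightarrow> \<exists>\<epsilon>. projective_resolution A M P d \<epsilon>)" by (rule someI_ex)
  then obtain \<eta> where Q: "projective_resolution A M Q e \<eta>" unfolding Qe by auto
  note QD = projective_resolutionD[OF Q] and PX = exact_augmented_resolution[OF lm P]
    and QX = exact_augmented_resolution[OF lm Q]
  have "M \<in> semi_gorenstein_projective A \<longleftrightarrow>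
      (\<forall>n. trivial_group (Ext_of_resolution A (Suc n) Q e ?N))"
    using M by (auto simp: semi_gorenstein_projective_def Ext_def Qe Suc_le_eq gr0_conv_Suc)
  also have "\<dots> \<longleftrightarrow> (\<forall>n. Hom_exact A ?N (Q (Suc (Suc n))) (e (Suc n)) (Q (Suc n)) (e n) (Q n))"
    using QD(7) projective_left_module[OF QD(2)]
    by (intro all_cong1 trivial_Ext_of_resolution_iff QD(3) N) (auto simp: a_kernel_eq)
  also have "\<dots> \<longleftrightarrow> (\<forall>n. Hom_exact A ?N (P (Suc (Suc n))) (d (Suc n)) (P (Suc n)) (d n) (P n))"
    using Hom_exact_independent[OF PX QX _ N, of "Suc _"] Hom_exact_independent[OF QX PX _ N, of "Suc _"]
    by auto
  finally show ?thesis .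
qed

section \<open>Closure properties of the semi-Gorenstein-projective modules\<close>

text \<open>
  Dimension shifting: dropping the first term of a resolution of \<open>M\<close> leaves a resolution
  of the syzygy whose Hom complex is a part of the old one.
\<close>

lemma syzygy_semi_gorenstein_projective:
  fixes \<iota> :: "'a list \<Rightarrow> 'm" and M :: "('a, 'm) module"
  assumes A: "ring A" and noeth: "left_noetherian A" and \<iota>: "inj \<iota>"
    and M: "M \<in> semi_gorenstein_projective A" and P: "projective_resolution A M P d \<epsilon>"
  shows "(P 0)\<lparr>carrier := a_kernel (P 0) M \<epsilon>\<rparr> \<in> semi_gorenstein_projective A"
proof -
  let ?K = "(P 0)\<lparr>carrier := a_kernel (P 0) M \<epsilon>\<rparr>"
  note R = projective_resolutionD[OF P]
  have Mfg: "M \<in> fg_modules A" using M by (simp add: semi_gorenstein_projective_def)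
  then have K: "?K \<in> fg_modules A"
    using fg_kernel[OF A noeth R(1) _ R(4)] by (simp add: fg_modules_def)
  have d0: "d 0 \<in> mod_hom A (P (Suc 0)) ?K"
    using P R(6) by (auto simp: projective_resolution_def mod_hom_def)
  have "projective_resolution A ?K (\<lambda>n. P (Suc n)) (\<lambda>n. d (Suc n)) (d 0)"
    unfolding projective_resolution_def
    using P R d0 by (auto simp: projective_resolution_def a_kernel_eq)
  from semi_gorenstein_projective_iff[OF A noeth \<iota> K this]
  show ?thesis using M semi_gorenstein_projective_iff[OF A noeth \<iota> Mfg P] by simp
qed

lemma projective_zero_module:
  fixes Z :: "('a, 'm) module"
  assumes Z: "left_module A Z" and "carrier Z = {\<zero>\<^bsub>Z\<^esub>}"
  shows "projective_module A Z"
proof (rule projective_moduleI[OF Z])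
  fix X Y :: "('a, 'm) module" and g h
  assume X: "left_module A X" and Y: "left_module A Y" and g: "lin A X Y g" and h: "lin A Z Y h"
  show "\<exists>k. lin A Z X k \<and> (\<forall>x\<in>carrier Z. g (k x) = h x)"
    using lin_const_zero[OF X, of Z] lin_zero[OF X Y g] lin_zero[OF Z Y h] assms(2)
    by (intro exI[of _ "\<lambda>_. \<zero>\<^bsub>X\<^esub>"]) auto
qed

text \<open>
  The resolution of \<open>P\<close> that is \<open>P\<close> in degree 0 and zero above has
  trivial cohomology in positive degrees.
\<close>

lemma projective_semi_gorenstein_projective:
  fixes \<iota> :: "'a list \<Rightarrow> 'm" and P :: "('a, 'm) module"
  assumes A: "ring A" and noeth: "left_noetherian A" and \<iota>: "inj \<iota>"
    and P: "P \<in> fg_modules A" "projective_module A P"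
  shows "P \<in> semi_gorenstein_projective A"
proof -
  have lP: "left_module A P" by (rule projective_left_module[OF P(2)])
  interpret P: left_module A P by (rule lP)
  define Z where "Z = P\<lparr>carrier := {\<zero>\<^bsub>P\<^esub>}\<rparr>"
  have Zs: "carrier Z = {\<zero>\<^bsub>Z\<^esub>}" "\<zero>\<^bsub>Z\<^esub> = \<zero>\<^bsub>P\<^esub>" by (simp_all add: Z_def)
  have lZ: "left_module A Z" unfolding Z_def by (rule left_module_submod[OF lP submod_zero[OF lP]])
  have pZ: "projective_module A Z" by (rule projective_zero_module[OF lZ Zs(1)])
  have fZ: "Z \<in> fg_modules A"
    using lZ fin_gen_zero[of A Z] Zs by (simp add: fg_modules_def finitely_generated_iff_fin_gen)
  define Q where "Q n = (case n of 0 \<Rightarrow> P | Suc _ \<Rightarrow> Z)" for n :: nat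
  define d where "d = (\<lambda>n :: nat. restrict (\<lambda>_. \<zero>\<^bsub>P\<^esub>) (carrier Z))"
  have Q: "Q 0 = P" "Q (Suc n) = Z" for n by (simp_all add: Q_def)
  have dP: "d n \<in> mod_hom A Z P" for n
    unfolding d_def by (rule restrict_mod_hom[OF lZ lin_const_zero[OF lP]])
  have dZ: "d n \<in> mod_hom A Z Z" for n
    using restrict_mod_hom[OF lZ lin_const_zero[OF lZ, of Z]] by (simp add: d_def Zs)
  have "projective_resolution A P Q d (restrict (\<lambda>x. x) (carrier P))"
    unfolding projective_resolution_def
  proof (intro conjI allI)
    fix n
    show "Q n \<in> fg_modules A" "projective_module A (Q n)"
      using P fZ pZ by (auto simp: Q_def split: nat.split)
    show "d n \<in> mod_hom A (Q (Suc n)) (Q n)" using dP dZ by (cases n) (auto simp: Q)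
    show "d (Suc n) ` carrier (Q (Suc (Suc n))) = a_kernel (Q (Suc n)) (Q n) (d n)"
      by (cases n) (auto simp: Q a_kernel_eq d_def Zs)
  next
    show "restrict (\<lambda>x. x) (carrier P) \<in> mod_hom A (Q 0) P"
      using restrict_mod_hom[OF lP lin_id] by (simp add: Q)
  qed (auto simp: Q a_kernel_eq d_def Zs)
  moreover have "Hom_exact A (regular_module A) (Q (Suc (Suc n))) (d (Suc n)) (Q (Suc n)) (d n) (Q n)" for n
    unfolding Hom_exact_def
  proof (intro allI impI)
    fix f assume "lin A (Q (Suc n)) (regular_module A) f"
    then have "f \<zero>\<^bsub>Z\<^esub> = \<zero>\<^bsub>regular_module A\<^esub>"
      unfolding Q by (rule lin_zero[OF lZ left_module_regular[OF A]])
    then show "\<exists>g. lin A (Q n) (regular_module A) g \<and> (\<forall>y\<in>carrier (Q (Suc n)). f y = g (d n y))"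
      using lin_const_zero[OF left_module_regular[OF A], of "Q n"] Zs(1)
      by (intro exI[of _ "\<lambda>_. \<zero>\<^bsub>regular_module A\<^esub>"]) (auto simp: Q)
  qed
  ultimately show ?thesis
    using semi_gorenstein_projective_iff[OF A noeth \<iota> P(1)] by blast
qed

lemma complete_projective_resolution_iff:
  assumes A: "ring A"
  shows "complete_projective_resolution A P d \<longleftrightarrow>
    (\<forall>i. P i \<in> fg_modules A \<and> projective_module A (P i)) \<and>
    (\<forall>i. d i \<in> mod_hom A (P i) (P (i + 1))) \<and>
    (\<forall>i. d i ` carrier (P i) = a_kernel (P (i + 1)) (P (i + 2)) (d (i + 1))) \<and>
    (\<forall>i. Hom_exact A (regular_module A) (P i) (d i) (P (i + 1)) (d (i + 1)) (P (i + 2)))"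
proof -
  have "(\<lambda>f. compose (carrier (P (i + 1))) f (d (i + 1))) ` mod_hom A (P (i + 2)) (regular_module A) =
      kernel (Hom_group A (P (i + 1)) (regular_module A)) (Hom_group A (P i) (regular_module A))
        (\<lambda>f. compose (carrier (P i)) f (d i)) \<longleftrightarrow>
      Hom_exact A (regular_module A) (P i) (d i) (P (i + 1)) (d (i + 1)) (P (i + 2))"
    if "\<forall>i. P i \<in> fg_modules A \<and> projective_module A (P i)" "\<forall>i. d i \<in> mod_hom A (P i) (P (i + 1))"
      "\<forall>i. d i ` carrier (P i) = a_kernel (P (i + 1)) (P (i + 2)) (d (i + 1))" for i
  proof (rule Hom_exact_iff_image_eq_kernel)
    show "left_module A (P i)" "left_module A (P (i + 1))" "left_module A (P (i + 2))"
      using that(1) projective_left_module by blast+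
    show "lin A (P i) (P (i + 1)) (d i)" using that(2) mod_hom_lin by blast
    show "lin A (P (i + 1)) (P (i + 2)) (d (i + 1))"
      using that(2)[rule_format, of "i + 1"] mod_hom_lin by (simp add: add.assoc)
    fix x assume "x \<in> carrier (P i)"
    then have "d i x \<in> a_kernel (P (i + 1)) (P (i + 2)) (d (i + 1))" using that(3) by blast
    then show "d (i + 1) (d i x) = \<zero>\<^bsub>P (i + 2)\<^esub>" by (simp add: a_kernel_eq)
  qed (rule left_module_regular[OF A])
  then show ?thesis
    unfolding complete_projective_resolution_def by (intro conj_cong iff_allI refl)
qed

text \<open>
  The nonpositive half of a complete projective resolution is a projective resolution of the
  image of its differential \<open>d 0\<close>, and exactness of the whole Hom complex contains the exactness needed
  for the vanishing of Ext.
\<close>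

lemma gorenstein_projective_semi:
  fixes \<iota> :: "'a list \<Rightarrow> 'm" and M :: "('a, 'm) module"
  assumes A: "ring A" and noeth: "left_noetherian A" and \<iota>: "inj \<iota>"
    and M: "M \<in> gorenstein_projective A"
  shows "M \<in> semi_gorenstein_projective A"
proof -
  have Mfg: "M \<in> fg_modules A" using M by (simp add: gorenstein_projective_def)
  then have lM: "left_module A M" by (simp add: fg_modules_def)
  obtain P :: "int \<Rightarrow> ('a, 'm) module" and d where C: "complete_projective_resolution A P d"
    and iso: "mod_isomorphic A M ((P 1)\<lparr>carrier := d 0 ` carrier (P 0)\<rparr>)"
    using M by (auto simp: gorenstein_projective_def)
  let ?I = "(P 1)\<lparr>carrier := d 0 ` carrier (P 0)\<rparr>"
  note C = C[unfolded complete_projective_resolution_iff[OF A]]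
  have P: "P i \<in> fg_modules A" "projective_module A (P i)" for i using C by blast+
  have d: "d i \<in> mod_hom A (P i) (P (i + 1))" for i using C by blast
  have im: "d i ` carrier (P i) = a_kernel (P (i + 1)) (P (i + 2)) (d (i + 1))" for i using C by blast
  have ex: "Hom_exact A (regular_module A) (P i) (d i) (P (i + 1)) (d (i + 1)) (P (i + 2))" for i
    using C by blast
  have lP: "left_module A (P i)" for i using P(2) by (rule projective_left_module)
  have d0: "lin A (P 0) (P 1) (d 0)" using mod_hom_lin[OF d[of 0]] by simp
  have lI: "left_module A ?I"
    by (rule left_module_submod[OF lP submod_image[OF lP lP d0 submod_carrier[OF lP]]])
  obtain \<theta> where \<theta>: "lin A M ?I \<theta>" "bij_betw \<theta> (carrier M) (carrier ?I)"
    using iso mod_hom_lin unfolding mod_isomorphic_def by blast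
  let ?\<eta> = "inv_into (carrier M) \<theta>"
  have \<eta>: "lin A ?I M ?\<eta>" by (rule lin_inv_into[OF lM \<theta>])
  have \<eta>bij: "bij_betw ?\<eta> (carrier ?I) (carrier M)" by (rule bij_betw_inv_into[OF \<theta>(2)])
  have d0I: "lin A (P 0) ?I (d 0)" using d0 by (auto simp: lin_def)
  have ker: "?\<eta> (d 0 x) = \<zero>\<^bsub>M\<^esub> \<longleftrightarrow> d 0 x = \<zero>\<^bsub>P 1\<^esub>" if x: "x \<in> carrier (P 0)" for x
  proof -
    have "?\<eta> (d 0 x) = ?\<eta> \<zero>\<^bsub>?I\<^esub> \<longleftrightarrow> d 0 x = \<zero>\<^bsub>?I\<^esub>"
      using \<eta>bij lin_closed[OF d0I x] submod_carrier[OF lI]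
      by (auto simp only: bij_betw_def submod_def inj_on_eq_iff)
    then show ?thesis using lin_zero[OF lI lM \<eta>] by simp
  qed
  (* Reindex the nonpositive half of the complete resolution by the natural numbers. *)
  define Q where "Q n = P (- int n)" for n
  define e where "e n = d (- int n - 1)" for n
  have QS: "Q (Suc n) = P (- int n - 1)" "Q (Suc (Suc n)) = P (- int n - 2)"
    "e (Suc n) = d (- int n - 2)" "Q 0 = P 0" "e 0 = d (- 1)" for n
    unfolding Q_def e_def by (rule arg_cong[where f = P] arg_cong[where f = d], simp)+
  have idx: "(- int n - 2) + 1 = - int n - 1" "(- int n - 2) + 2 = - int n"
    "(- int n - 1) + 1 = - int n" for n by simp_all
  define \<epsilon> where "\<epsilon> = restrict (\<lambda>x. ?\<eta> (d 0 x)) (carrier (P 0))"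
  have res: "projective_resolution A M Q e \<epsilon>"
    unfolding projective_resolution_def
  proof (intro conjI allI)
    fix n
    show "Q n \<in> fg_modules A" "projective_module A (Q n)" using P by (simp_all add: Q_def)
    show "e n \<in> mod_hom A (Q (Suc n)) (Q n)"
      using d[of "- int n - 1"] by (simp only: idx QS(1)[of n] Q_def[of n] e_def[of n])
    show "e (Suc n) ` carrier (Q (Suc (Suc n))) = a_kernel (Q (Suc n)) (Q n) (e n)"
      using im[of "- int n - 2"]
      by (simp only: idx QS(1-3)[of n] Q_def[of n] e_def[of n])
  next
    show "\<epsilon> \<in> mod_hom A (Q 0) M"
      unfolding \<epsilon>_def QS by (rule restrict_mod_hom[OF lP lin_comp[OF d0I \<eta>]])
    have "\<epsilon> ` carrier (P 0) = ?\<eta> ` d 0 ` carrier (P 0)" by (simp add: \<epsilon>_def image_image)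
    also have "\<dots> = carrier M" using \<eta>bij by (simp add: bij_betw_def)
    finally show "\<epsilon> ` carrier (Q 0) = carrier M" unfolding QS .
    have "a_kernel (P 0) M \<epsilon> = a_kernel (P 0) (P 1) (d 0)"
      using ker by (auto simp: a_kernel_eq \<epsilon>_def)
    then show "e 0 ` carrier (Q 1) = a_kernel (Q 0) M \<epsilon>"
      using im[of "- 1"] by (simp add: QS Q_def)
  qed
  have "Hom_exact A (regular_module A) (Q (Suc (Suc n))) (e (Suc n)) (Q (Suc n)) (e n) (Q n)" for n
    using ex[of "- int n - 2"] by (simp only: idx QS(1-3)[of n] Q_def[of n] e_def[of n])
  then show ?thesis using semi_gorenstein_projective_iff[OF A noeth \<iota> Mfg res] by blast
qed


section \<open>Splicing conflations\<close>

lemma conflation_lin: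
  assumes "conflation A F X Y Z f g"
  shows "lin A X Y f" and "lin A Y Z g" and "inj_on f (carrier X)"
    and "f ` carrier X = {y \<in> carrier Y. g y = \<zero>\<^bsub>Z\<^esub>}" and "g ` carrier Y = carrier Z"
  using assms by (auto simp: conflation_def short_exact_def mod_hom_iff a_kernel_eq)

text \<open>
  The differential is the composite \<open>P i \<rightarrow> X (i + 1) \<rightarrow> P (i + 1)\<close>.  The
  spliced sequence is exact because its pieces are.  A map on \<open>P (i + 1)\<close> that kills
  the differential factors through \<open>X (i + 2)\<close>, and extending this factor to
  \<open>P (i + 2)\<close> shows that the Hom complex is exact as well.
\<close>

lemma splice_complete_projective_resolution:
  fixes X P :: "int \<Rightarrow> ('a, 'm) module"
  assumes A: "ring A" and F: "F \<subseteq> fg_modules A"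
    and conf: "\<And>i. conflation A F (X i) (P i) (X (i + 1)) (f i) (g i)"
    and proj: "\<And>i. projective_module A (P i)"
    and ext: "\<And>i h. lin A (X i) (regular_module A) h \<Longrightarrow>
      \<exists>k. lin A (P i) (regular_module A) k \<and> (\<forall>x\<in>carrier (X i). k (f i x) = h x)"
  shows "X 1 \<in> gorenstein_projective A"
proof -
  let ?N = "regular_module A"
  define d where "d i = compose (carrier (P i)) (f (i + 1)) (g i)" for i
  have XF: "X i \<in> F" "P i \<in> F" for i using conf[of i] by (auto simp: conflation_def)
  then have lX: "left_module A (X i)" and lP: "left_module A (P i)" for i
    using F by (auto simp: fg_modules_def)
  note N = left_module_regular[OF A]
  have i2: "i + 1 + 1 = i + 2" for i :: int by simp
  have f: "lin A (X i) (P i) (f i)" and g: "lin A (P i) (X (i + 1)) (g i)"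
    and inj: "inj_on (f i) (carrier (X i))"
    and imf: "f i ` carrier (X i) = {y \<in> carrier (P i). g i y = \<zero>\<^bsub>X (i + 1)\<^esub>}"
    and img: "g i ` carrier (P i) = carrier (X (i + 1))" for i
    using conflation_lin[OF conf[of i]] by blast+
  have d_eq: "d i x = f (i + 1) (g i x)" if "x \<in> carrier (P i)" for i x
    using that by (simp add: d_def compose_def)
  have d: "d i \<in> mod_hom A (P i) (P (i + 1))" for i
    unfolding d_def compose_def by (rule restrict_mod_hom[OF lP lin_comp[OF g f]])
  have imd: "d i ` carrier (P i) = f (i + 1) ` carrier (X (i + 1))" for i
    unfolding img[symmetric] image_image by (intro image_cong refl d_eq)
  have f_zero: "f i x = \<zero>\<^bsub>P i\<^esub> \<longleftrightarrow> x = \<zero>\<^bsub>X i\<^esub>" if "x \<in> carrier (X i)" for i x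
    using inj_on_eq_iff[OF inj that, of "\<zero>\<^bsub>X i\<^esub>"] lin_zero[OF lX lP f] submod_carrier[OF lX]
    by (simp add: submod_def)
  have "d i ` carrier (P i) = a_kernel (P (i + 1)) (P (i + 2)) (d (i + 1))" for i
  proof -
    have "d (i + 1) y = \<zero>\<^bsub>P (i + 2)\<^esub> \<longleftrightarrow> g (i + 1) y = \<zero>\<^bsub>X (i + 2)\<^esub>" if y: "y \<in> carrier (P (i + 1))" for y
      using f_zero[OF lin_closed[OF g y]] d_eq[OF y] unfolding i2 by simp
    then show ?thesis unfolding imd imf a_kernel_eq i2 by blast
  qed
  moreover have "Hom_exact A ?N (P i) (d i) (P (i + 1)) (d (i + 1)) (P (i + 2))" for i
    unfolding Hom_exact_def
  proof (intro allI impI)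
    fix h assume h: "lin A (P (i + 1)) ?N h" and h0: "\<forall>x\<in>carrier (P i). h (d i x) = \<zero>\<^bsub>?N\<^esub>"
    have g': "lin A (P (i + 1)) (X (i + 2)) (g (i + 1))" "g (i + 1) ` carrier (P (i + 1)) = carrier (X (i + 2))"
      using g[of "i + 1"] img[of "i + 1"] unfolding i2 by blast+
    have "h y = \<zero>\<^bsub>?N\<^esub>" if "y \<in> carrier (P (i + 1))" "g (i + 1) y = \<zero>\<^bsub>X (i + 2)\<^esub>" for y
    proof -
      have "y \<in> d i ` carrier (P i)" using that unfolding imd imf i2 by simp
      then show ?thesis using h0 by blast
    qed
    from lin_factor_surj[OF lP lX N g' h this] obtain h' where h': "lin A (X (i + 2)) ?N h'"
      "\<And>y. y \<in> carrier (P (i + 1)) \<Longrightarrow> h' (g (i + 1) y) = h y" by blast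
    from ext[OF h'(1)] obtain k where k: "lin A (P (i + 2)) ?N k"
      "\<And>x. x \<in> carrier (X (i + 2)) \<Longrightarrow> k (f (i + 2) x) = h' x" by blast
    have "h y = k (d (i + 1) y)" if y: "y \<in> carrier (P (i + 1))" for y
      using d_eq[OF y] k(2)[OF lin_closed[OF g'(1) y]] h'(2)[OF y] unfolding i2 by simp
    then show "\<exists>k. lin A (P (i + 2)) ?N k \<and> (\<forall>y\<in>carrier (P (i + 1)). h y = k (d (i + 1) y))"
      using k(1) by blast
  qed
  ultimately have "complete_projective_resolution A P d"
    unfolding complete_projective_resolution_iff[OF A] using XF F proj d by blast
  moreover have "mod_isomorphic A (X 1) ((P 1)\<lparr>carrier := d 0 ` carrier (P 0)\<rparr>)"
    unfolding mod_isomorphic_def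
  proof (intro bexI)
    have im: "d 0 ` carrier (P 0) = f 1 ` carrier (X 1)" using imd[of 0] by simp
    show "bij_betw (f 1) (carrier (X 1)) (carrier ((P 1)\<lparr>carrier := d 0 ` carrier (P 0)\<rparr>))"
      using inj[of 1] im by (simp add: bij_betw_def)
    have "f 1 \<in> mod_hom A (X 1) (P 1)" using conf[of 1] by (simp add: conflation_def short_exact_def)
    then show "f 1 \<in> mod_hom A (X 1) ((P 1)\<lparr>carrier := d 0 ` carrier (P 0)\<rparr>)"
      unfolding im by (auto simp: mod_hom_def)
  qed
  ultimately show ?thesis using XF F unfolding gorenstein_projective_def by blast
qed

text \<open>
  To the left of \<open>M\<close>, deflations from projective objects are iterated, to the right, inflations into injective
  objects; in a Frobenius category both kinds of middle term are projective objects.  Both halves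
  start from \<open>M\<close> at index 1, because a complete resolution represents the
  image of \<open>d 0\<close>, which lies in degree 1.
\<close>

lemma frobenius_conflation_sequence:
  fixes M :: "('a, 'm) module"
  assumes frob: "frobenius_category A F" and M: "M \<in> F"
  obtains X P :: "int \<Rightarrow> ('a, 'm) module" and f g where "X 1 = M"
    and "\<And>i. P i \<in> projective_objects A F"
    and "\<And>i. conflation A F (X i) (P i) (X (i + 1)) (f i) (g i)"
proof -
  have "\<forall>Z. \<exists>X P f g. Z \<in> F \<longrightarrow> P \<in> projective_objects A F \<and> conflation A F X P Z f g"
    using frob unfolding frobenius_category_def by blast
  then obtain LX LP lf lg where L: "\<And>Z. Z \<in> F \<Longrightarrow> LP Z \<in> projective_objects A F"
    "\<And>Z. Z \<in> F \<Longrightarrow> conflation A F (LX Z) (LP Z) Z (lf Z) (lg Z)"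
    by metis
  have "\<forall>X. \<exists>I Z f g. X \<in> F \<longrightarrow> I \<in> projective_objects A F \<and> conflation A F X I Z f g"
    using frob unfolding frobenius_category_def by blast
  then obtain RX RP rf rg where R: "\<And>X. X \<in> F \<Longrightarrow> RP X \<in> projective_objects A F"
    "\<And>X. X \<in> F \<Longrightarrow> conflation A F X (RP X) (RX X) (rf X) (rg X)"
    by metis
  have lF: "(LX ^^ n) M \<in> F" for n
    by (induction n) (use M L(2) in \<open>auto simp: conflation_def\<close>)
  have rF: "(RX ^^ n) M \<in> F" for n
    by (induction n) (use M R(2) in \<open>auto simp: conflation_def\<close>)
  define X where "X i = (if i \<le> 1 then (LX ^^ nat (1 - i)) M else (RX ^^ nat (i - 1)) M)" for i :: int
  have X: "X i \<in> F" for i using lF rF by (simp add: X_def)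
  have left: "X i = LX (X (i + 1))" if "i \<le> 0" for i
  proof -
    have "nat (1 - i) = Suc (nat (- i))" using that by simp
    then show ?thesis using that by (simp add: X_def)
  qed
  have right: "X (i + 1) = RX (X i)" if "\<not> i \<le> 0" for i
  proof -
    have "nat i = Suc (nat (i - 1))" using that by simp
    then show ?thesis using that by (cases "i = 1") (simp_all add: X_def)
  qed
  show ?thesis
  proof (rule that)
    show "X 1 = M" by (simp add: X_def)
    fix i :: int
    show "(if i \<le> 0 then LP (X (i + 1)) else RP (X i)) \<in> projective_objects A F"
      using L(1) R(1) X by simp
    show "conflation A F (X i) (if i \<le> 0 then LP (X (i + 1)) else RP (X i)) (X (i + 1))
        (if i \<le> 0 then lf (X (i + 1)) else rf (X i)) (if i \<le> 0 then lg (X (i + 1)) else rg (X i))"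
      using L(2)[OF X[of "i + 1"]] R(2)[OF X[of i]] left[of i] right[of i] by auto
  qed
qed


section \<open>Projective objects\<close>

lemma projective_module_projective_object:
  assumes F: "F \<subseteq> fg_modules A" and P: "P \<in> F" "projective_module A P"
  shows "P \<in> projective_objects A F"
  unfolding projective_objects_def
proof (intro CollectI conjI allI impI P(1))
  fix X Y Z f g assume conf: "conflation A F X Y Z f g"
  then have "left_module A Y" "left_module A Z" "g \<in> mod_hom A Y Z" "g ` carrier Y = carrier Z"
    using F by (auto simp: conflation_def short_exact_def fg_modules_def)
  then show "\<forall>h\<in>mod_hom A P Z. \<exists>k\<in>mod_hom A P Y. compose (carrier P) g k = h"
    using P(2) unfolding projective_module_def by simp
qed

text \<open>
  Since \<open>Q\<close> and its syzygy are semi-Gorenstein-projective, they and the projective module between them lie in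
  \<open>F\<close>, so the presentation of \<open>Q\<close> is a conflation.  It splits
  because \<open>Q\<close> is a projective object, and a direct summand of a projective module is
  projective.
\<close>

lemma projective_object_projective_module:
  fixes \<iota> :: "'a list \<Rightarrow> 'm" and Q :: "('a, 'm) module"
  assumes A: "ring A" and noeth: "left_noetherian A" and \<iota>: "inj \<iota>"
    and perp: "semi_gorenstein_projective A \<subseteq> F"
    and Q: "Q \<in> projective_objects A F" "Q \<in> semi_gorenstein_projective A"
  shows "projective_module A Q"
proof -
  have Qfg: "Q \<in> fg_modules A" using Q(2) by (simp add: semi_gorenstein_projective_def)
  then have lQ: "left_module A Q" by (simp add: fg_modules_def)
  obtain P d \<epsilon> where res: "projective_resolution A Q P d \<epsilon>"
    using projective_resolution_exists[OF A noeth \<iota> Qfg] .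
  note R = projective_resolutionD[OF res]
  have lP: "left_module A (P 0)" by (rule projective_left_module[OF R(2)])
  let ?K = "(P 0)\<lparr>carrier := a_kernel (P 0) Q \<epsilon>\<rparr>"
  let ?i = "restrict (\<lambda>x. x) (carrier ?K)"
  have lK: "left_module A ?K" by (rule left_module_submod[OF lP submod_kernel[OF lP lQ R(4)]])
  have "lin A ?K (P 0) (\<lambda>x. x)" by (auto simp: lin_def a_kernel_eq)
  then have "?i \<in> mod_hom A ?K (P 0)" by (rule restrict_mod_hom[OF lK])
  moreover have "\<epsilon> \<in> mod_hom A (P 0) Q" using res by (simp add: projective_resolution_def)
  ultimately have "short_exact A ?K (P 0) Q ?i \<epsilon>"
    using R(5) by (auto simp: short_exact_def inj_on_def)
  moreover have "?K \<in> F"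
    using syzygy_semi_gorenstein_projective[OF A noeth \<iota> Q(2) res] perp by blast
  moreover have "P 0 \<in> F"
    using projective_semi_gorenstein_projective[OF A noeth \<iota> R(1,2)] perp by blast
  ultimately have conf: "conflation A F ?K (P 0) Q ?i \<epsilon>"
    using Q(2) perp by (auto simp: conflation_def)
  have "restrict (\<lambda>x. x) (carrier Q) \<in> mod_hom A Q Q" by (rule restrict_mod_hom[OF lQ lin_id])
  then obtain s where s: "s \<in> mod_hom A Q (P 0)"
    "compose (carrier Q) \<epsilon> s = restrict (\<lambda>x. x) (carrier Q)"
    using Q(1) conf unfolding projective_objects_def by blast
  have \<epsilon>s: "\<epsilon> (s x) = x" if "x \<in> carrier Q" for x
    using fun_cong[OF s(2), of x] that by (simp add: compose_def)
  show ?thesis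
  proof (rule projective_moduleI[OF lQ])
    fix Y Z :: "('a, 'm) module" and g h
    assume Y: "left_module A Y" and Z: "left_module A Z" and g: "lin A Y Z g" and h: "lin A Q Z h"
      and surj: "g ` carrier Y = carrier Z"
    have h\<epsilon>: "lin A (P 0) Z (\<lambda>x. h (\<epsilon> x))" by (rule lin_comp[OF R(4) h])
    then have "(\<lambda>x. h (\<epsilon> x)) ` carrier (P 0) \<subseteq> g ` carrier Y"
      unfolding surj using lin_closed[OF h\<epsilon>] by blast
    from projective_lift[OF R(2) Y Z g h\<epsilon> this] obtain k where k: "lin A (P 0) Y k"
      "\<And>x. x \<in> carrier (P 0) \<Longrightarrow> g (k x) = h (\<epsilon> x)" by blast
    have "g (k (s x)) = h x" if x: "x \<in> carrier Q" for x
      using k(2)[OF lin_closed[OF mod_hom_lin[OF s(1)] x]] \<epsilon>s[OF x] by simp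
    then show "\<exists>k. lin A Q Y k \<and> (\<forall>x\<in>carrier Q. g (k x) = h x)"
      using lin_comp[OF mod_hom_lin[OF s(1)] k(1)] by blast
  qed
qed

text \<open>
  The regular module itself has the wrong element type to be an object of
  \<open>F\<close>; a copy \<open>I\<close> of it in the universe serves to express that it is
  injective in \<open>F\<close>.
\<close>

lemma extend_to_regular_module:
  fixes I :: "('a, 'm) module"
  assumes F: "F \<subseteq> fg_modules A" and I: "I \<in> injective_objects A F"
    and s: "lin A I (regular_module A) s" "bij_betw s (carrier I) (carrier (regular_module A))"
    and conf: "conflation A F X Y Z f g" and h: "lin A X (regular_module A) h"
  shows "\<exists>k. lin A Y (regular_module A) k \<and> (\<forall>x\<in>carrier X. k (f x) = h x)"
proof -
  have lI: "left_module A I" and lX: "left_module A X"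
    using F I conf by (auto simp: injective_objects_def conflation_def fg_modules_def)
  let ?t = "inv_into (carrier I) s"
  have "restrict (\<lambda>x. ?t (h x)) (carrier X) \<in> mod_hom A X I"
    by (rule restrict_mod_hom[OF lX lin_comp[OF h lin_inv_into[OF lI s]]])
  then obtain k where k: "k \<in> mod_hom A Y I"
    "compose (carrier X) k f = restrict (\<lambda>x. ?t (h x)) (carrier X)"
    using I conf unfolding injective_objects_def by blast
  have "s (k (f x)) = h x" if x: "x \<in> carrier X" for x
  proof -
    have "h x \<in> s ` carrier I" using s(2) lin_closed[OF h x] by (simp add: bij_betw_def)
    then show ?thesis
      using fun_cong[OF k(2), of x] x by (simp add: compose_def f_inv_into_f)
  qed
  then show ?thesis using lin_comp[OF mod_hom_lin[OF k(1)] s(1)] by blast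
qed

theorem theorem1p4:
  fixes R :: "('r, 'y) ring_scheme" and \<phi> :: "'r \<Rightarrow> 'a" and A :: "('a, 'x) ring_scheme"
    and F :: "('a, 'm) module set" and \<iota> :: "'a list \<Rightarrow> 'm"
  assumes universe: "inj \<iota>"
    and artin: "artin_algebra R \<phi> A"
    and subcategory: "F \<subseteq> fg_modules A"
    and ext_closed: "extension_closed A F"
    and frobenius: "frobenius_category A F"
    and proj_perp: "projective_objects A F \<subseteq> semi_gorenstein_projective A"
    and perp_F: "semi_gorenstein_projective A \<subseteq> F"
  shows "left_weakly_gorenstein TYPE('m) A \<and> F = gorenstein_projective A"
proof -
  have A: "ring A" using artin by (simp add: artin_algebra_def)
  have noeth: "left_noetherian A" by (rule artin_algebra_noetherian[OF artin])
  obtain I :: "('a, 'm) module" and s where I: "I \<in> fg_modules A" "projective_module A I"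
    and s: "lin A I (regular_module A) s" "bij_betw s (carrier I) (carrier (regular_module A))"
    using regular_module_copy[OF A universe] .
  have "I \<in> F" using projective_semi_gorenstein_projective[OF A noeth universe I] perp_F by blast
  then have inj: "I \<in> injective_objects A F"
    using projective_module_projective_object[OF subcategory _ I(2)] frobenius
    by (simp add: frobenius_category_def)
  have "F \<subseteq> gorenstein_projective A"
  proof
    fix M assume "M \<in> F"
    then obtain X P :: "int \<Rightarrow> ('a, 'm) module" and f g where X: "X 1 = M"
      and P: "\<And>i. P i \<in> projective_objects A F"
      and conf: "\<And>i. conflation A F (X i) (P i) (X (i + 1)) (f i) (g i)"
      using frobenius_conflation_sequence[OF frobenius] by blast
    have "projective_module A (P i)" for i
      using projective_object_projective_module[OF A noeth universe perp_F P] proj_perp P by blast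
    then have "X 1 \<in> gorenstein_projective A"
      using extend_to_regular_module[OF subcategory inj s conf]
      by (intro splice_complete_projective_resolution[where X = X and P = P and f = f and g = g,
            OF A subcategory conf])
    then show "M \<in> gorenstein_projective A" using X by simp
  qed
  moreover have "(gorenstein_projective A :: ('a, 'm) module set) \<subseteq> semi_gorenstein_projective A"
    using gorenstein_projective_semi[OF A noeth universe] by blast
  ultimately show ?thesis using perp_F unfolding left_weakly_gorenstein_def by blast
qed

end
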